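(* Let $(k,\{\cdot,\cdot\})$ be a bidifferential field of characteristic zero and let $(R,\{\cdot,\cdot\})$ be an affine bidifferential $k$-algebra. Let $P$ be a prime bidifferential ideal of $R$. Then: (1) if $P$ is $B$-locally-closed then $P$ is $B$-primitive; (2) if moreover $k$ is contained in the constants of $(R,\{\cdot,\cdot\})$, then $P$ being $B$-primitive implies that $P$ is $B$-rational.
   Context: All rings are commutative and unital. A biderivation on a ring $R$ is a function $\{\cdot,\cdot\}:R\times R\to R$ such that for each $r\in R$ both $\{r,\cdot\}$ and $\{\cdot,r\}$ are derivations on $R$; $(R,\{\cdot,\cdot\})$ is then a bidifferential ring (field). An affine bidifferential $k$-algebra is a finitely generated $k$-algebra that is an integral domain, equipped with a biderivation extending the one on $k$. A bidifferential ideal of $R$ is an ideal $I$ with $\{R,I\}\subseteq I$ and $\{I,R\}\subseteq I$. The bidifferential core of an ideal $I$ is the largest bidifferential ideal contained in $I$ (it exists because sums of bidifferential ideals are bidifferential). $\operatorname{Spec}_B(R)$ is the set of prime bidifferential ideals of $R$. The constants of a bidifferential ring $(R,\{\cdot,\cdot\})$ are the elements $r\in R$ such that $\{r,\cdot\}$ and $\{\cdot,r\}$ are identically zero on $R$. Let $P\in\operatorname{Spec}_B(R)$. - $P$ is $B$-locally-closed if $P\neq\bigcap_{P\subsetneq Q\in\operatorname{Spec}_B(R)}Q$ (an empty intersection being $R$). - $P$ is $B$-primitive if it is the bidifferential core of a maximal ideal of $R$. - $P$ is $B$-rational if the constants of $\operatorname{Frac}(R/P)$ are contained in $k^{\mathrm{alg}}$,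 i.e. are algebraic over $k$. Here $R/P$ carries the induced biderivation, which extends uniquely to $\operatorname{Frac}(R/P)$. *)

theory Defs
  imports "HOL-Algebra.Algebra"
begin

no_notation Sum_Type.Plus (infixr \<open><+>\<close> 65)

section \<open>Bidifferential rings\<close>

definition derivation :: "('a, 'm) ring_scheme \<Rightarrow> ('a \<Rightarrow> 'a) \<Rightarrow> bool" where
  "derivation R d \<longleftrightarrow>
     d \<in> carrier R \<rightarrow> carrier R \<and>
     (\<forall>x \<in> carrier R. \<forall>y \<in> carrier R. d (x \<oplus>\<^bsub>R\<^esub> y) = d x \<oplus>\<^bsub>R\<^esub> d y) \<and>
     (\<forall>x \<in> carrier R. \<forall>y \<in> carrier R.
        d (x \<otimes>\<^bsub>R\<^esub> y) = d x \<otimes>\<^bsub>R\<^esub> y \<oplus>\<^bsub>R\<^esub> x \<otimes>\<^bsub>R\<^esub> d y)"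

definition biderivation :: "('a, 'm) ring_scheme \<Rightarrow> ('a \<Rightarrow> 'a \<Rightarrow> 'a) \<Rightarrow> bool" where
  "biderivation R bd \<longleftrightarrow>
     (\<forall>r \<in> carrier R. derivation R (\<lambda>s. bd r s) \<and> derivation R (\<lambda>s. bd s r))"

locale bidifferential_ring = cring R for R (structure) +
  fixes bd :: "'a \<Rightarrow> 'a \<Rightarrow> 'a"
  assumes biderivation: "biderivation R bd"

locale bidifferential_field = bidifferential_ring + field R

definition characteristic_zero :: "('a, 'm) ring_scheme \<Rightarrow> bool" where
  "characteristic_zero R \<longleftrightarrow> (\<forall>n::nat. n > 0 \<longrightarrow> add_pow R n \<one>\<^bsub>R\<^esub> \<noteq> \<zero>\<^bsub>R\<^esub>)"

text \<open>The $k$-algebra structure on $R$ is given by a ring homomorphism \<open>\<phi>\<close> from $k$ to $R$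
  (necessarily injective, as $k$ is a field and $R$ is a domain).\<close>

locale affine_bidifferential_algebra =
  base: bidifferential_field k bdk + bidifferential_ring R bd + domain R
  for k :: "('k, 'm) ring_scheme" and bdk and R :: "('a, 'n) ring_scheme" (structure) and bd +
  fixes \<phi> :: "'k \<Rightarrow> 'a"
  assumes structure_hom: "\<phi> \<in> ring_hom k R"
    and extends_base:
      "\<And>a b. a \<in> carrier k \<Longrightarrow> b \<in> carrier k \<Longrightarrow> bd (\<phi> a) (\<phi> b) = \<phi> (bdk a b)"
    and finitely_generated:
      "\<exists>S. finite S \<and> S \<subseteq> carrier R \<and> generate_ring R (\<phi> ` carrier k \<union> S) = carrier R"

definition constants :: "('a, 'm) ring_scheme \<Rightarrow> ('a \<Rightarrow> 'a \<Rightarrow> 'a) \<Rightarrow> 'a set" where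
  "constants R bd =
     {r \<in> carrier R. \<forall>s \<in> carrier R. bd r s = \<zero>\<^bsub>R\<^esub> \<and> bd s r = \<zero>\<^bsub>R\<^esub>}"


section \<open>Bidifferential ideals\<close>

definition bidifferential_ideal ::
    "('a, 'm) ring_scheme \<Rightarrow> ('a \<Rightarrow> 'a \<Rightarrow> 'a) \<Rightarrow> 'a set \<Rightarrow> bool" where
  "bidifferential_ideal R bd I \<longleftrightarrow>
     ideal I R \<and> (\<forall>r \<in> carrier R. \<forall>i \<in> I. bd r i \<in> I \<and> bd i r \<in> I)"

definition bidifferential_core ::
    "('a, 'm) ring_scheme \<Rightarrow> ('a \<Rightarrow> 'a \<Rightarrow> 'a) \<Rightarrow> 'a set \<Rightarrow> 'a set" where
  "bidifferential_core R bd I = (GREATEST J. bidifferential_ideal R bd J \<and> J \<subseteq> I)"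

definition Spec_B :: "('a, 'm) ring_scheme \<Rightarrow> ('a \<Rightarrow> 'a \<Rightarrow> 'a) \<Rightarrow> 'a set set" where
  "Spec_B R bd = {P. primeideal P R \<and> bidifferential_ideal R bd P}"

text \<open>Intersecting with the carrier makes the empty intersection equal to the whole ring.\<close>

definition B_locally_closed ::
    "('a, 'm) ring_scheme \<Rightarrow> ('a \<Rightarrow> 'a \<Rightarrow> 'a) \<Rightarrow> 'a set \<Rightarrow> bool" where
  "B_locally_closed R bd P \<longleftrightarrow> P \<noteq> carrier R \<inter> \<Inter> {Q \<in> Spec_B R bd. P \<subset> Q}"

definition B_primitive ::
    "('a, 'm) ring_scheme \<Rightarrow> ('a \<Rightarrow> 'a \<Rightarrow> 'a) \<Rightarrow> 'a set \<Rightarrow> bool" where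
  "B_primitive R bd P \<longleftrightarrow> (\<exists>M. maximalideal M R \<and> P = bidifferential_core R bd M)"


section \<open>Quotients and fraction fields\<close>

text \<open>The induced bracket on $R/P$, written in the same style as \<^const>\<open>rcoset_mult\<close>.\<close>

definition Quot_bd ::
    "('a, 'm) ring_scheme \<Rightarrow> ('a \<Rightarrow> 'a \<Rightarrow> 'a) \<Rightarrow> 'a set \<Rightarrow> 'a set \<Rightarrow> 'a set \<Rightarrow> 'a set" where
  "Quot_bd R bd P S T = (\<Union>x\<in>S. \<Union>y\<in>T. P +>\<^bsub>R\<^esub> bd x y)"

definition frac_rel :: "('a, 'm) ring_scheme \<Rightarrow> (('a \<times> 'a) \<times> ('a \<times> 'a)) set" where
  "frac_rel A = {((a, b), (c, d)) | a b c d.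
     a \<in> carrier A \<and> b \<in> carrier A - {\<zero>\<^bsub>A\<^esub>} \<and> c \<in> carrier A \<and> d \<in> carrier A - {\<zero>\<^bsub>A\<^esub>} \<and>
     a \<otimes>\<^bsub>A\<^esub> d = c \<otimes>\<^bsub>A\<^esub> b}"

definition fraction :: "('a, 'm) ring_scheme \<Rightarrow> 'a \<Rightarrow> 'a \<Rightarrow> ('a \<times> 'a) set" where
  "fraction A a b = frac_rel A `` {(a, b)}"

definition Frac :: "('a, 'm) ring_scheme \<Rightarrow> ('a \<times> 'a) set ring" where
  "Frac A =
     \<lparr>carrier = (carrier A \<times> (carrier A - {\<zero>\<^bsub>A\<^esub>})) // frac_rel A,
      monoid.mult = (\<lambda>S T. \<Union>x\<in>S. \<Union>y\<in>T. fraction A (fst x \<otimes>\<^bsub>A\<^esub> fst y) (snd x \<otimes>\<^bsub>A\<^esub> snd y)),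
      one = fraction A \<one>\<^bsub>A\<^esub> \<one>\<^bsub>A\<^esub>,
      ring.zero = fraction A \<zero>\<^bsub>A\<^esub> \<one>\<^bsub>A\<^esub>,
      add = (\<lambda>S T. \<Union>x\<in>S. \<Union>y\<in>T.
        fraction A (fst x \<otimes>\<^bsub>A\<^esub> snd y \<oplus>\<^bsub>A\<^esub> fst y \<otimes>\<^bsub>A\<^esub> snd x) (snd x \<otimes>\<^bsub>A\<^esub> snd y))\<rparr>"

definition to_Frac :: "('a, 'm) ring_scheme \<Rightarrow> 'a \<Rightarrow> ('a \<times> 'a) set" where
  "to_Frac A a = fraction A a \<one>\<^bsub>A\<^esub>"

definition extends_to_Frac :: "('a, 'm) ring_scheme \<Rightarrow> ('a \<Rightarrow> 'a \<Rightarrow> 'a) \<Rightarrow>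
    (('a \<times> 'a) set \<Rightarrow> ('a \<times> 'a) set \<Rightarrow> ('a \<times> 'a) set) \<Rightarrow> bool" where
  "extends_to_Frac A bd D \<longleftrightarrow> biderivation (Frac A) D \<and>
     (\<forall>a \<in> carrier A. \<forall>b \<in> carrier A. D (to_Frac A a) (to_Frac A b) = to_Frac A (bd a b))"

text \<open>The extension exists and is unique on the carrier of the fraction field; see
  \<open>Frac_bd_extends\<close> and \<open>extends_to_Frac_unique\<close> below.\<close>

definition Frac_bd :: "('a, 'm) ring_scheme \<Rightarrow> ('a \<Rightarrow> 'a \<Rightarrow> 'a) \<Rightarrow>
    ('a \<times> 'a) set \<Rightarrow> ('a \<times> 'a) set \<Rightarrow> ('a \<times> 'a) set" where
  "Frac_bd A bd = (SOME D. extends_to_Frac A bd D)"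

definition B_rational :: "('k, 'l) ring_scheme \<Rightarrow> ('k \<Rightarrow> 'a) \<Rightarrow>
    ('a, 'm) ring_scheme \<Rightarrow> ('a \<Rightarrow> 'a \<Rightarrow> 'a) \<Rightarrow> 'a set \<Rightarrow> bool" where
  "B_rational k \<phi> R bd P \<longleftrightarrow>
     (let A = R Quot P; F = Frac A; K = (\<lambda>c. to_Frac A (P +>\<^bsub>R\<^esub> (\<phi> c))) ` carrier k
      in \<forall>x \<in> constants F (Frac_bd A (Quot_bd R bd P)). (ring.algebraic F over K) x)"


section \<open>Well-definedness\<close>

subsection \<open>The bidifferential core\<close>

context bidifferential_ring
begin

lemma bd_closed [simp, intro]: "a \<in> carrier R \<Longrightarrow> b \<in> carrier R \<Longrightarrow> bd a b \<in> carrier R"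
  using biderivation by (auto simp: biderivation_def derivation_def)

lemma bd_add_right: "a \<in> carrier R \<Longrightarrow> b \<in> carrier R \<Longrightarrow> c \<in> carrier R \<Longrightarrow>
    bd a (b \<oplus> c) = bd a b \<oplus> bd a c"
  and bd_add_left: "a \<in> carrier R \<Longrightarrow> b \<in> carrier R \<Longrightarrow> c \<in> carrier R \<Longrightarrow>
    bd (b \<oplus> c) a = bd b a \<oplus> bd c a"
  and bd_mult_right: "a \<in> carrier R \<Longrightarrow> b \<in> carrier R \<Longrightarrow> c \<in> carrier R \<Longrightarrow>
    bd a (b \<otimes> c) = bd a b \<otimes> c \<oplus> b \<otimes> bd a c"
  and bd_mult_left: "a \<in> carrier R \<Longrightarrow> b \<in> carrier R \<Longrightarrow> c \<in> carrier R \<Longrightarrow>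
    bd (b \<otimes> c) a = bd b a \<otimes> c \<oplus> b \<otimes> bd c a"
  using biderivation by (auto simp: biderivation_def derivation_def)

lemma bidifferential_ideal_add:
  assumes I: "bidifferential_ideal R bd I" and J: "bidifferential_ideal R bd J"
  shows "bidifferential_ideal R bd (I <+> J)"
proof -
  interpret I: ideal I R using I by (simp add: bidifferential_ideal_def)
  interpret J: ideal J R using J by (simp add: bidifferential_ideal_def)
  have "bd r x \<in> I <+> J \<and> bd x r \<in> I <+> J" if r: "r \<in> carrier R" and x: "x \<in> I <+> J" for r x
  proof -
    obtain i j where ij: "i \<in> I" "j \<in> J" "x = i \<oplus> j"
      using x by (auto simp: set_add_def')
    then have "bd r x = bd r i \<oplus> bd r j" "bd x r = bd i r \<oplus> bd j r"
      using r by (simp_all add: bd_add_left bd_add_right)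
    moreover have "bd r i \<in> I" "bd i r \<in> I" "bd r j \<in> J" "bd j r \<in> J"
      using I J r ij by (auto simp: bidifferential_ideal_def)
    ultimately show ?thesis
      by (auto simp: set_add_def')
  qed
  then show ?thesis
    using add_ideals[OF I.ideal_axioms J.ideal_axioms] by (simp add: bidifferential_ideal_def)
qed

lemma bidifferential_ideal_zero: "bidifferential_ideal R bd {\<zero>}"
proof -
  have "bd r \<zero> \<oplus> bd r \<zero> = bd r \<zero>" "bd \<zero> r \<oplus> bd \<zero> r = bd \<zero> r" if "r \<in> carrier R" for r
    using that bd_add_right[of r \<zero> \<zero>] bd_add_left[of r \<zero> \<zero>] by simp_all
  then show ?thesis
    by (simp add: bidifferential_ideal_def zeroideal)
qed

lemma bidifferential_core_greatest:
  assumes "ideal I R"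
  shows "bidifferential_ideal R bd (bidifferential_core R bd I)"
    and "bidifferential_core R bd I \<subseteq> I"
    and "\<And>J. bidifferential_ideal R bd J \<Longrightarrow> J \<subseteq> I \<Longrightarrow> J \<subseteq> bidifferential_core R bd I"
proof -
  interpret I: ideal I R by fact
  let ?S = "{J. bidifferential_ideal R bd J \<and> J \<subseteq> I}"
  let ?U = "\<Union>?S"
  have id: "ideal J R" if "J \<in> ?S" for J
    using that by (simp add: bidifferential_ideal_def)
  have sum: "x \<oplus> y \<in> ?U" if xy: "x \<in> ?U" "y \<in> ?U" for x y
  proof -
    from xy obtain J K where J: "x \<in> J" "J \<in> ?S" and K: "y \<in> K" "K \<in> ?S" by blast
    then have "J <+> K \<in> ?S"
      using bidifferential_ideal_add[of J K] by (auto simp: set_add_def')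
    moreover have "x \<oplus> y \<in> J <+> K"
      using J K by (auto simp: set_add_def')
    ultimately show ?thesis by blast
  qed
  have "ideal ?U R"
  proof (rule idealI[OF ring_axioms])
    show "subgroup ?U (add_monoid R)"
    proof (rule add.subgroupI)
      show "?U \<subseteq> carrier R" using I.a_subset by auto
      have "{\<zero>} \<in> ?S" by (simp add: bidifferential_ideal_zero)
      then show "?U \<noteq> {}" by blast
      show "\<And>a. a \<in> ?U \<Longrightarrow> \<ominus> a \<in> ?U"
        using id additive_subgroup.a_inv_closed ideal.axioms(1) by (metis (no_types, lifting) UnionE UnionI)
      show "\<And>a b. a \<in> ?U \<Longrightarrow> b \<in> ?U \<Longrightarrow> a \<oplus> b \<in> ?U" by (rule sum)
    qed
    show "\<And>a x. a \<in> ?U \<Longrightarrow> x \<in> carrier R \<Longrightarrow> x \<otimes> a \<in> ?U"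
      using id ideal.I_l_closed by (metis (no_types, lifting) UnionE UnionI)
    show "\<And>a x. a \<in> ?U \<Longrightarrow> x \<in> carrier R \<Longrightarrow> a \<otimes> x \<in> ?U"
      using id ideal.I_r_closed by (metis (no_types, lifting) UnionE UnionI)
  qed
  then have U: "bidifferential_ideal R bd ?U"
    unfolding bidifferential_ideal_def by (auto simp: bidifferential_ideal_def)
  have "bidifferential_core R bd I = ?U"
    unfolding bidifferential_core_def using U by (intro Greatest_equality) auto
  then show "bidifferential_ideal R bd (bidifferential_core R bd I)"
    and "bidifferential_core R bd I \<subseteq> I"
    and "\<And>J. bidifferential_ideal R bd J \<Longrightarrow> J \<subseteq> I \<Longrightarrow> J \<subseteq> bidifferential_core R bd I"
    using U by auto
qed


subsection \<open>The bracket on the quotient\<close>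

lemma Quot_bd_coset:
  assumes P: "bidifferential_ideal R bd P" and r: "r \<in> carrier R" and s: "s \<in> carrier R"
  shows "Quot_bd R bd P (P +> r) (P +> s) = P +> bd r s"
proof -
  interpret P: ideal P R using P by (simp add: bidifferential_ideal_def)
  have *: "P +> bd x y = P +> bd r s" if x: "x \<in> P +> r" and y: "y \<in> P +> s" for x y
  proof -
    obtain p q where pq: "p \<in> P" "q \<in> P" "x = p \<oplus> r" "y = q \<oplus> s"
      using x y by (auto simp: a_r_coset_def')
    have "bd x y = (bd p y \<oplus> bd r q) \<oplus> bd r s"
      using pq r s by (simp add: bd_add_left bd_add_right a_ac)
    moreover have "bd p y \<oplus> bd r q \<in> P"
      using P pq r s by (auto simp: bidifferential_ideal_def)
    ultimately have "bd x y \<in> P +> bd r s"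
      by (auto simp: a_r_coset_def')
    then show ?thesis
      using r s a_repr_independence[OF _ bd_closed[OF r s] P.is_additive_subgroup[THEN additive_subgroup.a_subgroup]] by simp
  qed
  have "r \<in> P +> r" "s \<in> P +> s"
    using r s P.a_rcos_self by auto
  moreover have "Quot_bd R bd P (P +> r) (P +> s) = (\<Union>x\<in>P +> r. \<Union>y\<in>P +> s. P +> bd r s)"
    unfolding Quot_bd_def by (intro SUP_cong refl *)
  ultimately show ?thesis
    by auto
qed

lemma Quot_bidifferential_ring:
  assumes P: "bidifferential_ideal R bd P"
  shows "bidifferential_ring (R Quot P) (Quot_bd R bd P)"
proof -
  interpret P: ideal P R using P by (simp add: bidifferential_ideal_def)
  have car: "\<exists>r\<in>carrier R. S = P +> r" if "S \<in> carrier (R Quot P)" for S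
    using that by (auto simp: FactRing_simps)
  have ops: "(P +> r) \<oplus>\<^bsub>R Quot P\<^esub> (P +> s) = P +> (r \<oplus> s)"
     "(P +> r) \<otimes>\<^bsub>R Quot P\<^esub> (P +> s) = P +> (r \<otimes> s)" "P +> r \<in> carrier (R Quot P)"
    if "r \<in> carrier R" "s \<in> carrier R" for r s
    using that by (auto simp: FactRing_simps P.a_rcos_sum P.rcoset_mult_add)
  have "biderivation (R Quot P) (Quot_bd R bd P)"
    unfolding biderivation_def derivation_def
    by (auto dest!: car simp: ops Quot_bd_coset[OF P] bd_add_left bd_add_right bd_mult_left bd_mult_right)
  then show ?thesis
    using P.quotient_is_cring[OF cring_axioms]
    by (intro bidifferential_ring.intro bidifferential_ring_axioms.intro)
qed

end


subsection \<open>The fraction field\<close>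

context domain
begin

abbreviation (input) nz :: "'a set" where "nz \<equiv> carrier R - {\<zero>}"

lemma nz_mult: "b \<in> nz \<Longrightarrow> d \<in> nz \<Longrightarrow> b \<otimes> d \<in> nz"
  by (auto simp: integral_iff)

lemma equiv_frac_rel: "equiv (carrier R \<times> nz) (frac_rel R)"
proof (rule equivI)
  show "frac_rel R \<subseteq> (carrier R \<times> nz) \<times> (carrier R \<times> nz)"
    by (auto simp: frac_rel_def)
  show "refl_on (carrier R \<times> nz) (frac_rel R)"
    by (auto simp: refl_on_def frac_rel_def)
  show "sym (frac_rel R)"
    by (auto simp: sym_def frac_rel_def)
  show "trans (frac_rel R)"
  proof (rule transI)
    fix x y z assume "(x, y) \<in> frac_rel R" "(y, z) \<in> frac_rel R"
    then obtain a b c d e f where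
      xyz: "x = (a, b)" "y = (c, d)" "z = (e, f)"
      and car: "a \<in> carrier R" "b \<in> nz" "c \<in> carrier R" "d \<in> nz" "e \<in> carrier R" "f \<in> nz"
      and eq: "a \<otimes> d = c \<otimes> b" "c \<otimes> f = e \<otimes> d"
      unfolding frac_rel_def by auto
    have "d \<otimes> (a \<otimes> f) = (a \<otimes> d) \<otimes> f" using car by (simp add: m_ac)
    also have "\<dots> = (c \<otimes> f) \<otimes> b" using car eq(1) by (simp add: m_ac)
    also have "\<dots> = d \<otimes> (e \<otimes> b)" using car eq(2) by (simp add: m_ac)
    finally have "a \<otimes> f = e \<otimes> b"
      using car m_lcancel[of d "a \<otimes> f" "e \<otimes> b"] by auto
    then show "(x, z) \<in> frac_rel R"
      using xyz car by (auto simp: frac_rel_def)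
  qed
qed

lemma frac_eq_iff:
  assumes "a \<in> carrier R" "b \<in> nz" "c \<in> carrier R" "d \<in> nz"
  shows "fraction R a b = fraction R c d \<longleftrightarrow> a \<otimes> d = c \<otimes> b"
  unfolding fraction_def using eq_equiv_class_iff[OF equiv_frac_rel, of "(a, b)" "(c, d)"] assms
  by (auto simp: frac_rel_def)

lemma frac_closed [simp, intro]:
  "a \<in> carrier R \<Longrightarrow> b \<in> nz \<Longrightarrow> fraction R a b \<in> carrier (Frac R)"
  by (auto simp: Frac_def fraction_def intro!: quotientI)

lemma Frac_cases:
  assumes "x \<in> carrier (Frac R)"
  obtains a b where "a \<in> carrier R" "b \<in> nz" "x = fraction R a b"
  using assms by (auto simp: Frac_def fraction_def elim!: quotientE)

lemma frac_mult:
  assumes "a \<in> carrier R" "b \<in> nz" "c \<in> carrier R" "d \<in> nz"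
  shows "fraction R a b \<otimes>\<^bsub>Frac R\<^esub> fraction R c d = fraction R (a \<otimes> c) (b \<otimes> d)"
proof -
  let ?f = "\<lambda>x y. fraction R (fst x \<otimes> fst y) (snd x \<otimes> snd y)"
  have "congruent2 (frac_rel R) (frac_rel R) ?f"
  proof (rule congruent2_commuteI[OF equiv_frac_rel])
    show "\<And>y z. y \<in> carrier R \<times> nz \<Longrightarrow> z \<in> carrier R \<times> nz \<Longrightarrow> ?f y z = ?f z y"
      by (auto simp: m_comm)
    fix y z w assume "(y, z) \<in> frac_rel R" "w \<in> carrier R \<times> nz"
    then obtain a b c d e f where
      xyz: "y = (a, b)" "z = (c, d)" "w = (e, f)"
      and car: "a \<in> carrier R" "b \<in> nz" "c \<in> carrier R" "d \<in> nz" "e \<in> carrier R" "f \<in> nz"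
      and eq: "a \<otimes> d = c \<otimes> b"
      unfolding frac_rel_def by (cases y, cases z, cases w) simp
    have "(e \<otimes> a) \<otimes> (f \<otimes> d) = (e \<otimes> f) \<otimes> (a \<otimes> d)" using car by (simp add: m_ac)
    also have "\<dots> = (e \<otimes> c) \<otimes> (f \<otimes> b)" using car eq by (simp add: m_ac)
    finally show "?f w y = ?f w z"
      using xyz car nz_mult by (subst frac_eq_iff) auto
  qed
  then show ?thesis
    using UN_equiv_class2[OF equiv_frac_rel equiv_frac_rel, of ?f "(a, b)" "(c, d)"] assms
    by (simp add: Frac_def fraction_def)
qed

lemma frac_add:
  assumes "a \<in> carrier R" "b \<in> nz" "c \<in> carrier R" "d \<in> nz"
  shows "fraction R a b \<oplus>\<^bsub>Frac R\<^esub> fraction R c d = fraction R (a \<otimes> d \<oplus> c \<otimes> b) (b \<otimes> d)"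
proof -
  let ?f = "\<lambda>x y. fraction R (fst x \<otimes> snd y \<oplus> fst y \<otimes> snd x) (snd x \<otimes> snd y)"
  have "congruent2 (frac_rel R) (frac_rel R) ?f"
  proof (rule congruent2_commuteI[OF equiv_frac_rel])
    show "\<And>y z. y \<in> carrier R \<times> nz \<Longrightarrow> z \<in> carrier R \<times> nz \<Longrightarrow> ?f y z = ?f z y"
      by (auto simp: m_comm a_comm)
    fix y z w assume "(y, z) \<in> frac_rel R" "w \<in> carrier R \<times> nz"
    then obtain a b c d e f where
      xyz: "y = (a, b)" "z = (c, d)" "w = (e, f)"
      and car: "a \<in> carrier R" "b \<in> nz" "c \<in> carrier R" "d \<in> nz" "e \<in> carrier R" "f \<in> nz"
      and eq: "a \<otimes> d = c \<otimes> b"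
      unfolding frac_rel_def by (cases y, cases z, cases w) simp
    have "(e \<otimes> b \<oplus> a \<otimes> f) \<otimes> (f \<otimes> d) = e \<otimes> b \<otimes> f \<otimes> d \<oplus> f \<otimes> f \<otimes> (a \<otimes> d)"
      using car by (simp add: m_ac l_distr r_distr)
    also have "\<dots> = (e \<otimes> d \<oplus> c \<otimes> f) \<otimes> (f \<otimes> b)"
      using car by (simp add: eq m_ac l_distr r_distr)
    finally show "?f w y = ?f w z"
      using xyz car nz_mult by (subst frac_eq_iff) auto
  qed
  then show ?thesis
    using UN_equiv_class2[OF equiv_frac_rel equiv_frac_rel, of ?f "(a, b)" "(c, d)"] assms
    by (simp add: Frac_def fraction_def)
qed

lemma frac_one: "\<one>\<^bsub>Frac R\<^esub> = fraction R \<one> \<one>" and frac_zero: "\<zero>\<^bsub>Frac R\<^esub> = fraction R \<zero> \<one>"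
  by (simp_all add: Frac_def)

lemma one_nz: "\<one> \<in> nz" by simp

lemma Frac_cring: "cring (Frac R)"
proof (rule cringI)
  show "abelian_group (Frac R)"
  proof (rule abelian_groupI)
    show "\<zero>\<^bsub>Frac R\<^esub> \<in> carrier (Frac R)" by (simp add: frac_zero)
    fix x assume "x \<in> carrier (Frac R)"
    then obtain a b where x: "a \<in> carrier R" "b \<in> nz" "x = fraction R a b" by (rule Frac_cases)
    show "\<zero>\<^bsub>Frac R\<^esub> \<oplus>\<^bsub>Frac R\<^esub> x = x"
      using x by (simp add: frac_zero frac_add one_nz)
    show "\<exists>y\<in>carrier (Frac R). y \<oplus>\<^bsub>Frac R\<^esub> x = \<zero>\<^bsub>Frac R\<^esub>"
    proof
      show "fraction R (\<ominus> a) b \<in> carrier (Frac R)" using x by simp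
      have "\<ominus> a \<otimes> b \<oplus> a \<otimes> b = \<zero>" using x by (simp add: l_minus l_neg)
      then show "fraction R (\<ominus> a) b \<oplus>\<^bsub>Frac R\<^esub> x = \<zero>\<^bsub>Frac R\<^esub>"
        using x nz_mult[of b b] by (simp add: frac_zero frac_add frac_eq_iff)
    qed
    fix y assume "y \<in> carrier (Frac R)"
    then obtain c d where y: "c \<in> carrier R" "d \<in> nz" "y = fraction R c d" by (rule Frac_cases)
    note bd = nz_mult[OF x(2) y(2)]
    show "x \<oplus>\<^bsub>Frac R\<^esub> y \<in> carrier (Frac R)"
      using x y bd by (subst x(3), subst y(3)) (simp add: frac_add)
    show "x \<oplus>\<^bsub>Frac R\<^esub> y = y \<oplus>\<^bsub>Frac R\<^esub> x"
      using x y by (simp add: frac_add m_comm a_comm)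
    fix z assume "z \<in> carrier (Frac R)"
    then obtain e f where z: "e \<in> carrier R" "f \<in> nz" "z = fraction R e f" by (rule Frac_cases)
    note df = nz_mult[OF y(2) z(2)]
    show "x \<oplus>\<^bsub>Frac R\<^esub> y \<oplus>\<^bsub>Frac R\<^esub> z = x \<oplus>\<^bsub>Frac R\<^esub> (y \<oplus>\<^bsub>Frac R\<^esub> z)"
      using x y z bd df by (simp add: frac_add m_ac a_ac l_distr r_distr)
  qed
  show "comm_monoid (Frac R)"
  proof (rule comm_monoidI)
    show "\<one>\<^bsub>Frac R\<^esub> \<in> carrier (Frac R)" by (simp add: frac_one)
    fix x assume "x \<in> carrier (Frac R)"
    then obtain a b where x: "a \<in> carrier R" "b \<in> nz" "x = fraction R a b" by (rule Frac_cases)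
    show "\<one>\<^bsub>Frac R\<^esub> \<otimes>\<^bsub>Frac R\<^esub> x = x"
      using x by (simp add: frac_one frac_mult)
    fix y assume "y \<in> carrier (Frac R)"
    then obtain c d where y: "c \<in> carrier R" "d \<in> nz" "y = fraction R c d" by (rule Frac_cases)
    note bd = nz_mult[OF x(2) y(2)]
    show "x \<otimes>\<^bsub>Frac R\<^esub> y \<in> carrier (Frac R)"
      using x y bd by (subst x(3), subst y(3)) (simp add: frac_mult)
    show "x \<otimes>\<^bsub>Frac R\<^esub> y = y \<otimes>\<^bsub>Frac R\<^esub> x"
      using x y by (simp add: frac_mult m_comm)
    fix z assume "z \<in> carrier (Frac R)"
    then obtain e f where z: "e \<in> carrier R" "f \<in> nz" "z = fraction R e f" by (rule Frac_cases)
    note df = nz_mult[OF y(2) z(2)]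
    show "x \<otimes>\<^bsub>Frac R\<^esub> y \<otimes>\<^bsub>Frac R\<^esub> z = x \<otimes>\<^bsub>Frac R\<^esub> (y \<otimes>\<^bsub>Frac R\<^esub> z)"
      using x y z bd df by (simp add: frac_mult m_ac)
  qed
  fix x y z
  assume "x \<in> carrier (Frac R)" "y \<in> carrier (Frac R)" "z \<in> carrier (Frac R)"
  then obtain a b c d e f where
    x: "a \<in> carrier R" "b \<in> nz" "x = fraction R a b" and
    y: "c \<in> carrier R" "d \<in> nz" "y = fraction R c d" and
    z: "e \<in> carrier R" "f \<in> nz" "z = fraction R e f" by (metis Frac_cases)
  note nzs = nz_mult[OF x(2) y(2)] nz_mult[OF y(2) z(2)] nz_mult[OF x(2) z(2)]
  have nzs2: "b \<otimes> d \<otimes> f \<in> nz" "b \<otimes> f \<otimes> (d \<otimes> f) \<in> nz"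
    using nzs x y z nz_mult by metis+
  show "(x \<oplus>\<^bsub>Frac R\<^esub> y) \<otimes>\<^bsub>Frac R\<^esub> z = x \<otimes>\<^bsub>Frac R\<^esub> z \<oplus>\<^bsub>Frac R\<^esub> y \<otimes>\<^bsub>Frac R\<^esub> z"
    using x y z nzs nzs2
    by (simp add: frac_add frac_mult frac_eq_iff m_ac l_distr r_distr)
qed

lemma Frac_field: "field (Frac R)"
proof (rule cring.cring_fieldI2[OF Frac_cring])
  show "\<zero>\<^bsub>Frac R\<^esub> \<noteq> \<one>\<^bsub>Frac R\<^esub>"
    by (simp add: frac_zero frac_one frac_eq_iff)
  fix x assume "x \<in> carrier (Frac R)" "x \<noteq> \<zero>\<^bsub>Frac R\<^esub>"
  then obtain a b where x: "a \<in> carrier R" "b \<in> nz" "x = fraction R a b" by (metis Frac_cases)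
  have "a \<noteq> \<zero>"
    using x \<open>x \<noteq> \<zero>\<^bsub>Frac R\<^esub>\<close> by (auto simp: frac_zero frac_eq_iff)
  with x have a: "a \<in> nz" by simp
  show "\<exists>y\<in>carrier (Frac R). x \<otimes>\<^bsub>Frac R\<^esub> y = \<one>\<^bsub>Frac R\<^esub>"
  proof
    show "fraction R b a \<in> carrier (Frac R)" using x a by simp
    show "x \<otimes>\<^bsub>Frac R\<^esub> fraction R b a = \<one>\<^bsub>Frac R\<^esub>"
      using x a nz_mult[of b a] by (simp add: frac_mult frac_one frac_eq_iff m_comm)
  qed
qed

lemma to_Frac_hom: "to_Frac R \<in> ring_hom R (Frac R)"
  by (rule ring_hom_memI) (auto simp: to_Frac_def frac_mult frac_add frac_one)

lemma to_Frac_inj: "inj_on (to_Frac R) (carrier R)"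
  by (auto simp: inj_on_def to_Frac_def frac_eq_iff)

lemma Frac_quotient:
  assumes "x \<in> carrier (Frac R)"
  obtains a b where "a \<in> carrier R" "b \<in> nz" "x \<otimes>\<^bsub>Frac R\<^esub> to_Frac R b = to_Frac R a"
proof -
  obtain a b where x: "a \<in> carrier R" "b \<in> nz" "x = fraction R a b"
    using assms by (rule Frac_cases)
  then have "x \<otimes>\<^bsub>Frac R\<^esub> to_Frac R b = to_Frac R a"
    by (simp add: to_Frac_def frac_mult frac_eq_iff m_comm)
  with x that show thesis by blast
qed

end


subsection \<open>Extending the bracket to the fraction field\<close>

locale domain_in_field = A: domain A + field K
  for A :: "('a, 'm) ring_scheme" and K :: "('b, 'n) ring_scheme" (structure) +
  fixes \<iota> :: "'a \<Rightarrow> 'b"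
  assumes hom: "\<iota> \<in> ring_hom A K"
    and inj: "inj_on \<iota> (carrier A)"
    and quot: "x \<in> carrier K \<Longrightarrow>
      \<exists>a \<in> carrier A. \<exists>b \<in> carrier A - {\<zero>\<^bsub>A\<^esub>}. x \<otimes> \<iota> b = \<iota> a"
begin

lemma \<iota>_simps [simp]:
  "a \<in> carrier A \<Longrightarrow> \<iota> a \<in> carrier K"
  "a \<in> carrier A \<Longrightarrow> b \<in> carrier A \<Longrightarrow> \<iota> (a \<oplus>\<^bsub>A\<^esub> b) = \<iota> a \<oplus> \<iota> b"
  "a \<in> carrier A \<Longrightarrow> b \<in> carrier A \<Longrightarrow> \<iota> (a \<otimes>\<^bsub>A\<^esub> b) = \<iota> a \<otimes> \<iota> b"
  "\<iota> \<one>\<^bsub>A\<^esub> = \<one>"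
  using hom by (auto simp: ring_hom_def)

lemma \<iota>_nonzero: "b \<in> carrier A - {\<zero>\<^bsub>A\<^esub>} \<Longrightarrow> \<iota> b \<noteq> \<zero>"
  using inj ring_hom_zero[OF hom A.ring_axioms ring_axioms]
  by (metis A.zero_closed Diff_iff inj_on_contraD singletonI)

definition derivation_along :: "('a \<Rightarrow> 'b) \<Rightarrow> bool" where
  "derivation_along d \<longleftrightarrow>
     d \<in> carrier A \<rightarrow> carrier K \<and>
     (\<forall>a \<in> carrier A. \<forall>b \<in> carrier A. d (a \<oplus>\<^bsub>A\<^esub> b) = d a \<oplus> d b) \<and>
     (\<forall>a \<in> carrier A. \<forall>b \<in> carrier A. d (a \<otimes>\<^bsub>A\<^esub> b) = d a \<otimes> \<iota> b \<oplus> \<iota> a \<otimes> d b)"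

lemma derivation_unique:
  assumes D: "derivation K D" "derivation K D'"
    and eq: "\<And>a. a \<in> carrier A \<Longrightarrow> D (\<iota> a) = D' (\<iota> a)"
    and x: "x \<in> carrier K"
  shows "D x = D' x"
proof -
  obtain a b where ab: "a \<in> carrier A" "b \<in> carrier A - {\<zero>\<^bsub>A\<^esub>}" "x \<otimes> \<iota> b = \<iota> a"
    using quot[OF x] by blast
  have car: "D x \<in> carrier K" "D' x \<in> carrier K" "D (\<iota> b) \<in> carrier K"
    using D x ab by (auto simp: derivation_def)
  have "D x \<otimes> \<iota> b \<oplus> x \<otimes> D (\<iota> b) = D (x \<otimes> \<iota> b)"
    using D(1) x ab(1,2) by (simp add: derivation_def)
  also have "\<dots> = D' (x \<otimes> \<iota> b)"
    using ab eq by simp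
  also have "\<dots> = D' x \<otimes> \<iota> b \<oplus> x \<otimes> D (\<iota> b)"
    using D(2) x ab(1,2) eq by (simp add: derivation_def)
  finally have "D x \<otimes> \<iota> b = D' x \<otimes> \<iota> b"
    using car x ab add.r_cancel by simp
  then show ?thesis
    using car ab \<iota>_nonzero[of b] m_rcancel[of "\<iota> b"] by simp
qed

lemma biderivation_unique:
  assumes D: "biderivation K D" "biderivation K D'"
    and eq: "\<And>a b. a \<in> carrier A \<Longrightarrow> b \<in> carrier A \<Longrightarrow> D (\<iota> a) (\<iota> b) = D' (\<iota> a) (\<iota> b)"
    and x: "x \<in> carrier K" and y: "y \<in> carrier K"
  shows "D x y = D' x y"
proof (rule derivation_unique[where D = "\<lambda>x. D x y" and D' = "\<lambda>x. D' x y", OF _ _ _ x])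
  show "derivation K (\<lambda>x. D x y)" "derivation K (\<lambda>x. D' x y)"
    using D y by (simp_all add: biderivation_def)
  fix a assume a: "a \<in> carrier A"
  show "D (\<iota> a) y = D' (\<iota> a) y"
    using D a eq by - (rule derivation_unique[OF _ _ _ y], simp_all add: biderivation_def)
qed

lemma derivation_along_extends:
  assumes d: "derivation_along d"
  obtains D where "derivation K D" "\<And>a. a \<in> carrier A \<Longrightarrow> D (\<iota> a) = d a"
    "\<And>x a b. x \<in> carrier K \<Longrightarrow> a \<in> carrier A \<Longrightarrow> b \<in> carrier A - {\<zero>\<^bsub>A\<^esub>} \<Longrightarrow>
       x \<otimes> \<iota> b = \<iota> a \<Longrightarrow> D x \<otimes> \<iota> b \<oplus> x \<otimes> d b = d a"
proof -
  have d_car [simp]: "d a \<in> carrier K" if "a \<in> carrier A" for a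
    using d that by (auto simp: derivation_along_def)
  have d_add: "d (a \<oplus>\<^bsub>A\<^esub> b) = d a \<oplus> d b"
    and d_mult: "d (a \<otimes>\<^bsub>A\<^esub> b) = d a \<otimes> \<iota> b \<oplus> \<iota> a \<otimes> d b"
    if "a \<in> carrier A" "b \<in> carrier A" for a b
    using d that by (auto simp: derivation_along_def)
  have ex: "\<exists>z \<in> carrier K. \<forall>a \<in> carrier A. \<forall>b \<in> carrier A - {\<zero>\<^bsub>A\<^esub>}.
      x \<otimes> \<iota> b = \<iota> a \<longrightarrow> z \<otimes> \<iota> b \<oplus> x \<otimes> d b = d a" if x: "x \<in> carrier K" for x
  proof -
    obtain a b where ab: "a \<in> carrier A" "b \<in> carrier A - {\<zero>\<^bsub>A\<^esub>}" "x \<otimes> \<iota> b = \<iota> a"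
      using quot[OF x] by blast
    define z where "z = (d a \<ominus> x \<otimes> d b) \<otimes> inv (\<iota> b)"
    have unit: "\<iota> b \<in> Units K"
      using ab \<iota>_nonzero[of b] field_Units by simp
    have z: "z \<in> carrier K"
      using x ab unit by (simp add: z_def)
    have "z \<otimes> \<iota> b = d a \<ominus> x \<otimes> d b"
      using x ab unit by (simp add: z_def m_assoc)
    then have za: "z \<otimes> \<iota> b \<oplus> x \<otimes> d b = d a"
      using x ab by (simp add: minus_eq a_assoc l_neg)
    have "z \<otimes> \<iota> b' \<oplus> x \<otimes> d b' = d a'"
      if a': "a' \<in> carrier A" and b': "b' \<in> carrier A - {\<zero>\<^bsub>A\<^esub>}" and eq: "x \<otimes> \<iota> b' = \<iota> a'" for a' b'
    proof -
      have "\<iota> (a \<otimes>\<^bsub>A\<^esub> b') = \<iota> (a' \<otimes>\<^bsub>A\<^esub> b)"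
        using a' b' ab x by (simp add: eq[symmetric] ab(3)[symmetric] m_ac del: ab(3))
      then have "a \<otimes>\<^bsub>A\<^esub> b' = a' \<otimes>\<^bsub>A\<^esub> b"
        using a' b' ab by (intro inj_onD[OF inj]) auto
      then have "d a \<otimes> \<iota> b' \<oplus> \<iota> a \<otimes> d b' = d a' \<otimes> \<iota> b \<oplus> \<iota> a' \<otimes> d b"
        using a' b' ab d_mult by (metis DiffD1)
      then have *: "(z \<otimes> \<iota> b \<oplus> x \<otimes> d b) \<otimes> \<iota> b' \<oplus> (x \<otimes> \<iota> b) \<otimes> d b'
          = d a' \<otimes> \<iota> b \<oplus> (x \<otimes> \<iota> b') \<otimes> d b"
        by (simp only: za ab eq)
      have "(z \<otimes> \<iota> b' \<oplus> x \<otimes> d b') \<otimes> \<iota> b \<oplus> (x \<otimes> \<iota> b') \<otimes> d b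
          = (z \<otimes> \<iota> b \<oplus> x \<otimes> d b) \<otimes> \<iota> b' \<oplus> (x \<otimes> \<iota> b) \<otimes> d b'"
        using z x a' b' ab(1,2) by (simp add: l_distr r_distr m_ac a_ac)
      with * have "(z \<otimes> \<iota> b' \<oplus> x \<otimes> d b') \<otimes> \<iota> b = d a' \<otimes> \<iota> b"
        using z x a' b' ab(1,2) add.r_cancel by simp
      then show ?thesis
        using z x a' b' ab(1,2) \<iota>_nonzero[of b] m_rcancel[of "\<iota> b"] by simp
    qed
    with z show ?thesis by blast
  qed
  then obtain D where D_car: "\<And>x. x \<in> carrier K \<Longrightarrow> D x \<in> carrier K"
    and D: "\<And>x a b. x \<in> carrier K \<Longrightarrow> a \<in> carrier A \<Longrightarrow> b \<in> carrier A - {\<zero>\<^bsub>A\<^esub>} \<Longrightarrow>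
       x \<otimes> \<iota> b = \<iota> a \<Longrightarrow> D x \<otimes> \<iota> b \<oplus> x \<otimes> d b = d a"
    by metis
  have cancel: "z = w" if "z \<otimes> \<iota> b \<oplus> x \<otimes> d b = w \<otimes> \<iota> b \<oplus> x \<otimes> d b"
    "z \<in> carrier K" "w \<in> carrier K" "x \<in> carrier K" "b \<in> carrier A - {\<zero>\<^bsub>A\<^esub>}" for z w x b
  proof -
    have "z \<otimes> \<iota> b = w \<otimes> \<iota> b"
      using that add.r_cancel[of "x \<otimes> d b" "z \<otimes> \<iota> b" "w \<otimes> \<iota> b"] by simp
    then show ?thesis
      using that \<iota>_nonzero[of b] m_rcancel[of "\<iota> b" z w] by simp
  qed
  have "derivation K D"
    unfolding derivation_def
  proof (intro conjI ballI)
    show "D \<in> carrier K \<rightarrow> carrier K" using D_car by simp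
    fix x y assume x: "x \<in> carrier K" and y: "y \<in> carrier K"
    obtain a b where ab: "a \<in> carrier A" "b \<in> carrier A - {\<zero>\<^bsub>A\<^esub>}" "x \<otimes> \<iota> b = \<iota> a"
      using quot[OF x] by blast
    obtain c e where ce: "c \<in> carrier A" "e \<in> carrier A - {\<zero>\<^bsub>A\<^esub>}" "y \<otimes> \<iota> e = \<iota> c"
      using quot[OF y] by blast
    note car = ab(1,2) ce(1,2) x y D_car[OF x] D_car[OF y]
    have be: "b \<otimes>\<^bsub>A\<^esub> e \<in> carrier A - {\<zero>\<^bsub>A\<^esub>}"
      using car A.nz_mult by blast
    note Dx = D[OF x ab] and Dy = D[OF y ce]
    show "D (x \<oplus> y) = D x \<oplus> D y"
    proof (rule cancel[of _ "b \<otimes>\<^bsub>A\<^esub> e" "x \<oplus> y"])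
      have s: "(x \<oplus> y) \<otimes> \<iota> (b \<otimes>\<^bsub>A\<^esub> e) = \<iota> (a \<otimes>\<^bsub>A\<^esub> e \<oplus>\<^bsub>A\<^esub> c \<otimes>\<^bsub>A\<^esub> b)"
        using car by (simp add: ab(3)[symmetric] ce(3)[symmetric] l_distr r_distr m_ac)
      have "D (x \<oplus> y) \<otimes> \<iota> (b \<otimes>\<^bsub>A\<^esub> e) \<oplus> (x \<oplus> y) \<otimes> d (b \<otimes>\<^bsub>A\<^esub> e)
          = d (a \<otimes>\<^bsub>A\<^esub> e \<oplus>\<^bsub>A\<^esub> c \<otimes>\<^bsub>A\<^esub> b)"
        using car be by (intro D[OF _ _ _ s]) auto
      also have "\<dots> = d a \<otimes> \<iota> e \<oplus> \<iota> a \<otimes> d e \<oplus> (d c \<otimes> \<iota> b \<oplus> \<iota> c \<otimes> d b)"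
        using car by (simp add: d_add d_mult)
      also have "\<dots> = (D x \<oplus> D y) \<otimes> \<iota> (b \<otimes>\<^bsub>A\<^esub> e) \<oplus> (x \<oplus> y) \<otimes> d (b \<otimes>\<^bsub>A\<^esub> e)"
        using car by (simp add: Dx[symmetric] Dy[symmetric] ab(3)[symmetric] ce(3)[symmetric]
            d_mult l_distr r_distr m_ac a_ac)
      finally show "D (x \<oplus> y) \<otimes> \<iota> (b \<otimes>\<^bsub>A\<^esub> e) \<oplus> (x \<oplus> y) \<otimes> d (b \<otimes>\<^bsub>A\<^esub> e)
        = (D x \<oplus> D y) \<otimes> \<iota> (b \<otimes>\<^bsub>A\<^esub> e) \<oplus> (x \<oplus> y) \<otimes> d (b \<otimes>\<^bsub>A\<^esub> e)" .
    qed (use car be D_car in auto)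
    show "D (x \<otimes> y) = D x \<otimes> y \<oplus> x \<otimes> D y"
    proof (rule cancel[of _ "b \<otimes>\<^bsub>A\<^esub> e" "x \<otimes> y"])
      have s: "(x \<otimes> y) \<otimes> \<iota> (b \<otimes>\<^bsub>A\<^esub> e) = \<iota> (a \<otimes>\<^bsub>A\<^esub> c)"
        using car by (simp add: ab(3)[symmetric] ce(3)[symmetric] m_ac)
      have "D (x \<otimes> y) \<otimes> \<iota> (b \<otimes>\<^bsub>A\<^esub> e) \<oplus> (x \<otimes> y) \<otimes> d (b \<otimes>\<^bsub>A\<^esub> e) = d (a \<otimes>\<^bsub>A\<^esub> c)"
        using car be by (intro D[OF _ _ _ s]) auto
      also have "\<dots> = d a \<otimes> \<iota> c \<oplus> \<iota> a \<otimes> d c"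
        using car by (simp add: d_mult)
      also have "\<dots> = (D x \<otimes> y \<oplus> x \<otimes> D y) \<otimes> \<iota> (b \<otimes>\<^bsub>A\<^esub> e) \<oplus> (x \<otimes> y) \<otimes> d (b \<otimes>\<^bsub>A\<^esub> e)"
        using car by (simp add: Dx[symmetric] Dy[symmetric] ab(3)[symmetric] ce(3)[symmetric]
            d_mult l_distr r_distr m_ac a_ac)
      finally show "D (x \<otimes> y) \<otimes> \<iota> (b \<otimes>\<^bsub>A\<^esub> e) \<oplus> (x \<otimes> y) \<otimes> d (b \<otimes>\<^bsub>A\<^esub> e)
        = (D x \<otimes> y \<oplus> x \<otimes> D y) \<otimes> \<iota> (b \<otimes>\<^bsub>A\<^esub> e) \<oplus> (x \<otimes> y) \<otimes> d (b \<otimes>\<^bsub>A\<^esub> e)" .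
    qed (use car be D_car in auto)
  qed
  moreover have "D (\<iota> a) = d a" if a: "a \<in> carrier A" for a
  proof -
    have one: "d \<one>\<^bsub>A\<^esub> = \<zero>"
    proof -
      have "d \<one>\<^bsub>A\<^esub> = d \<one>\<^bsub>A\<^esub> \<oplus> d \<one>\<^bsub>A\<^esub>"
        using d_mult[of "\<one>\<^bsub>A\<^esub>" "\<one>\<^bsub>A\<^esub>"] by simp
      then show ?thesis using add.r_cancel_one' d_car by (metis A.one_closed)
    qed
    have "D (\<iota> a) \<otimes> \<iota> \<one>\<^bsub>A\<^esub> \<oplus> \<iota> a \<otimes> d \<one>\<^bsub>A\<^esub> = d a"
      using a by (intro D) auto
    then show ?thesis using a one D_car by simp
  qed
  ultimately show thesis using D that by blast
qed

text \<open>For fixed \<open>x\<close>, one extends \<open>bd \<cdot> b\<close> to $K$ for every \<open>b\<close> in $A$,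
  and then the resulting \<open>A \<rightarrow> K\<close> derivation \<open>b \<mapsto> E b x\<close> to $K$.\<close>

lemma biderivation_extends:
  assumes bd: "biderivation A bd"
  shows "\<exists>D. biderivation K D \<and>
    (\<forall>a \<in> carrier A. \<forall>b \<in> carrier A. D (\<iota> a) (\<iota> b) = \<iota> (bd a b))"
proof -
  interpret bidifferential_ring A bd
    using bd A.cring_axioms by (simp add: bidifferential_ring_def bidifferential_ring_axioms_def)
  have "\<exists>E. derivation K E \<and> (\<forall>a \<in> carrier A. E (\<iota> a) = \<iota> (bd a s))" if "s \<in> carrier A" for s
  proof -
    have "derivation_along (\<lambda>a. \<iota> (bd a s))"
      using that by (simp add: derivation_along_def bd_add_left bd_mult_left)
    then show ?thesis by (rule derivation_along_extends) blast
  qed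
  then obtain E where E: "\<And>s. s \<in> carrier A \<Longrightarrow> derivation K (E s)"
    and E_\<iota>: "\<And>s a. s \<in> carrier A \<Longrightarrow> a \<in> carrier A \<Longrightarrow> E s (\<iota> a) = \<iota> (bd a s)"
    by metis
  have E_car [simp]: "E s x \<in> carrier K"
    and E_add: "y \<in> carrier K \<Longrightarrow> E s (x \<oplus> y) = E s x \<oplus> E s y"
    and E_mult: "y \<in> carrier K \<Longrightarrow> E s (x \<otimes> y) = E s x \<otimes> y \<oplus> x \<otimes> E s y"
    if "s \<in> carrier A" "x \<in> carrier K" for s x y
    using E[OF that(1)] that by (auto simp: derivation_def)
  have lin: "derivation K (\<lambda>x. E s x \<oplus> E t x)" if "s \<in> carrier A" "t \<in> carrier A" for s t
    using that by (simp add: derivation_def E_add E_mult l_distr r_distr m_ac a_ac)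
  have lin2: "derivation K (\<lambda>x. E s x \<otimes> \<iota> t \<oplus> \<iota> s \<otimes> E t x)"
    if "s \<in> carrier A" "t \<in> carrier A" for s t
    using that by (simp add: derivation_def E_add E_mult l_distr r_distr m_ac a_ac)
  have Es_add: "E (s \<oplus>\<^bsub>A\<^esub> t) x = E s x \<oplus> E t x"
    if "s \<in> carrier A" "t \<in> carrier A" "x \<in> carrier K" for s t x
    using that by - (rule derivation_unique[OF E lin], simp_all add: E_\<iota> bd_add_right)
  have Es_mult: "E (s \<otimes>\<^bsub>A\<^esub> t) x = E s x \<otimes> \<iota> t \<oplus> \<iota> s \<otimes> E t x"
    if "s \<in> carrier A" "t \<in> carrier A" "x \<in> carrier K" for s t x
    using that by - (rule derivation_unique[OF E lin2], simp_all add: E_\<iota> bd_mult_right)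
  have "\<exists>D. derivation K D \<and> (\<forall>b \<in> carrier A. D (\<iota> b) = E b x)" if "x \<in> carrier K" for x
  proof -
    have "derivation_along (\<lambda>b. E b x)"
      using that by (simp add: derivation_along_def Es_add Es_mult)
    then show ?thesis by (rule derivation_along_extends) blast
  qed
  then obtain D where D: "\<And>x. x \<in> carrier K \<Longrightarrow> derivation K (D x)"
    and D_\<iota>: "\<And>x b. x \<in> carrier K \<Longrightarrow> b \<in> carrier A \<Longrightarrow> D x (\<iota> b) = E b x"
    by metis
  have D_car [simp]: "D x y \<in> carrier K"
    and D_add: "z \<in> carrier K \<Longrightarrow> D x (y \<oplus> z) = D x y \<oplus> D x z"
    and D_mult: "z \<in> carrier K \<Longrightarrow> D x (y \<otimes> z) = D x y \<otimes> z \<oplus> y \<otimes> D x z"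
    if "x \<in> carrier K" "y \<in> carrier K" for x y z
    using D[OF that(1)] that by (auto simp: derivation_def)
  have lin3: "derivation K (\<lambda>y. D u y \<oplus> D v y)" if "u \<in> carrier K" "v \<in> carrier K" for u v
    using that by (simp add: derivation_def D_add D_mult l_distr r_distr m_ac a_ac)
  have lin4: "derivation K (\<lambda>y. D u y \<otimes> v \<oplus> u \<otimes> D v y)"
    if "u \<in> carrier K" "v \<in> carrier K" for u v
    using that by (simp add: derivation_def D_add D_mult l_distr r_distr m_ac a_ac)
  have D1_add: "D (u \<oplus> v) y = D u y \<oplus> D v y"
    if "u \<in> carrier K" "v \<in> carrier K" "y \<in> carrier K" for u v y
    using that by - (rule derivation_unique[OF D lin3], simp_all add: D_\<iota> E_add)
  have D1_mult: "D (u \<otimes> v) y = D u y \<otimes> v \<oplus> u \<otimes> D v y"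
    if "u \<in> carrier K" "v \<in> carrier K" "y \<in> carrier K" for u v y
    using that by - (rule derivation_unique[OF D lin4], simp_all add: D_\<iota> E_mult)
  have "biderivation K D"
    by (simp add: biderivation_def derivation_def D_add D_mult D1_add D1_mult)
  moreover have "\<forall>a \<in> carrier A. \<forall>b \<in> carrier A. D (\<iota> a) (\<iota> b) = \<iota> (bd a b)"
    by (simp add: D_\<iota> E_\<iota>)
  ultimately show ?thesis by blast
qed

end

lemma (in domain) domain_in_field_Frac: "domain_in_field R (Frac R) (to_Frac R)"
proof -
  interpret F: field "Frac R" by (rule Frac_field)
  show ?thesis
    by unfold_locales (auto intro: to_Frac_hom to_Frac_inj elim!: Frac_quotient)
qed

lemma (in domain) Frac_bd_extends:
  assumes "biderivation R bd"
  shows "extends_to_Frac R bd (Frac_bd R bd)"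
  using domain_in_field.biderivation_extends[OF domain_in_field_Frac assms]
  unfolding Frac_bd_def extends_to_Frac_def by (rule someI_ex)

lemma (in domain) extends_to_Frac_unique:
  assumes "extends_to_Frac R bd D" "extends_to_Frac R bd D'"
    and "x \<in> carrier (Frac R)" "y \<in> carrier (Frac R)"
  shows "D x y = D' x y"
  using assms
  by - (rule domain_in_field.biderivation_unique[OF domain_in_field_Frac],
        simp_all add: extends_to_Frac_def)

lemma Frac_Quot_bidifferential_field:
  assumes "bidifferential_ring R bd" and "P \<in> Spec_B R bd"
  shows "bidifferential_field (Frac (R Quot P)) (Frac_bd (R Quot P) (Quot_bd R bd P))"
proof -
  interpret bidifferential_ring R bd by fact
  interpret Q: bidifferential_ring "R Quot P" "Quot_bd R bd P"
    using assms by (intro Quot_bidifferential_ring) (simp add: Spec_B_def)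
  interpret Q: domain "R Quot P"
    using assms by (intro primeideal.quotient_is_domain) (simp add: Spec_B_def)
  interpret F: field "Frac (R Quot P)" by (rule Q.Frac_field)
  show ?thesis
    using Q.Frac_bd_extends[OF Q.biderivation]
    by unfold_locales (simp add: extends_to_Frac_def)
qed

end

(* Part (1): let f outside P lie in every prime bidifferential ideal strictly above P. The Jacobson
   property of finitely generated k-algebras gives a maximal ideal M containing P but not f. In characteristic zero the core of a prime ideal is prime, so the core of M is P.
   The Jacobson property is reached through G-domains: in R/M, with M maximal among the ideals above P
   missing all powers of f, every nonzero element divides a power of the image of f. This property
   descends from B[u] to B and makes u algebraic over B, so R/M is algebraic over k, hence a field.

   Part (2): let P be the core of the maximal ideal M and x a constant of Frac(R/P). The denominators
   of x form a bidifferential ideal that is not contained in P, hence not in M, so x has a value in the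
   field R/M, which is algebraic over k; say q is a nonzero polynomial vanishing at this value. If the constant
   q(x) were nonzero, then 1/q(x) would also have a value in R/M, although q(x) has value zero. *)
theory Submission
  imports Defs
begin

section \<open>Finitely generated G-domains over a field\<close>

text \<open>The ideal \<open>M\<close> of part (1) has to miss \<open>f\<close> and be maximal at
  the same time. An ideal maximal among those missing the powers of \<open>f\<close> is in general
  only prime; finite generation over a field closes the gap. With \<open>f = \<one>\<close> the same
  argument is Zariski's lemma, which part (2) uses for its residue field. The difficulty in the
  descent is that \<open>u\<close> is algebraic over \<open>B\<close>, so elements of
  \<open>B[u]\<close> have neither unique coefficients nor well-defined leading terms. Everything is
  therefore phrased through representations of bounded length, and the descent invokes uniqueness
  only below the least degree of a relation. The core of a prime ideal is first seen to be radical,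
  where differentiating a power produces an integer factor that has to be divided out; primality
  then follows from colon ideals. In part (2) the coefficients of \<open>q\<close> come from
  \<open>k\<close>, whose elements are constants. This makes \<open>q(x)\<close>, and with it
  \<open>1/q(x)\<close>, a constant to which the denominator argument applies again.\<close>

text \<open>Kaplansky's G-domains: inverting the single element \<open>f\<close> already yields the fraction field.\<close>

definition (in ring) G_subring :: "'a set \<Rightarrow> bool" where
  "G_subring C \<longleftrightarrow>
     (\<exists>f \<in> C - {\<zero>}. \<forall>a \<in> C - {\<zero>}. \<exists>g \<in> C. \<exists>n::nat. a \<otimes> g = f [^] n)"

lemma (in domain) pow_nonzero: "x \<in> carrier R \<Longrightarrow> x \<noteq> \<zero> \<Longrightarrow> x [^] (n::nat) \<noteq> \<zero>"
  by (induction n) (auto simp: integral_iff)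

section \<open>The degree filtration of \<open>B[u]\<close>\<close>

locale adjoined_element = domain R for R (structure) +
  fixes B :: "'a set" and u :: 'a
  assumes subring_B: "subring B R" and u_closed [simp]: "u \<in> carrier R"
begin

text \<open>The \<open>B\<close>-span of \<open>1, ..., u^(n-1)\<close>. Leading coefficients may be
  zero, so this bounds the degree of some representation of an element; it stays meaningful when
  \<open>u\<close> is algebraic over \<open>B\<close>.\<close>

definition deg_less :: "nat \<Rightarrow> 'a set" where
  "deg_less n = {eval p u | p. set p \<subseteq> B \<and> length p = n}"

lemma B_closed [simp]: "b \<in> B \<Longrightarrow> b \<in> carrier R"
  using subringE(1)[OF subring_B] by blast

lemma B_ops [simp]:
  "\<zero> \<in> B" "\<one> \<in> B"
  "b \<in> B \<Longrightarrow> \<ominus> b \<in> B"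
  "b \<in> B \<Longrightarrow> c \<in> B \<Longrightarrow> b \<oplus> c \<in> B"
  "b \<in> B \<Longrightarrow> c \<in> B \<Longrightarrow> b \<otimes> c \<in> B"
  using subringE[OF subring_B] by auto

lemma B_pow [simp]: "b \<in> B \<Longrightarrow> b [^] (n::nat) \<in> B"
  by (induction n) auto

lemma deg_less_0 [simp]: "deg_less 0 = {\<zero>}"
  by (auto simp: deg_less_def)

text \<open>Splits off the head of the coefficient list, which belongs to the highest power. The
  inductions on degree below run on this recursion rather than on lists.\<close>

lemma deg_less_Suc_iff:
  "v \<in> deg_less (Suc n) \<longleftrightarrow> (\<exists>b \<in> B. \<exists>w \<in> deg_less n. v = b \<otimes> u [^] n \<oplus> w)"
proof
  assume "v \<in> deg_less (Suc n)"
  then obtain p where p: "set p \<subseteq> B" "length p = Suc n" "v = eval p u"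
    by (auto simp: deg_less_def)
  then obtain b q where "p = b # q" by (cases p) auto
  with p show "\<exists>b \<in> B. \<exists>w \<in> deg_less n. v = b \<otimes> u [^] n \<oplus> w"
    by (auto simp: deg_less_def)
next
  assume "\<exists>b \<in> B. \<exists>w \<in> deg_less n. v = b \<otimes> u [^] n \<oplus> w"
  then obtain b p where "b \<in> B" "set p \<subseteq> B" "length p = n" "v = eval (b # p) u"
    by (auto simp: deg_less_def)
  then show "v \<in> deg_less (Suc n)"
    unfolding deg_less_def by (intro CollectI exI[of _ "b # p"]) auto
qed

lemma deg_less_SucI:
  "b \<in> B \<Longrightarrow> w \<in> deg_less n \<Longrightarrow> b \<otimes> u [^] n \<oplus> w \<in> deg_less (Suc n)"
  by (auto simp: deg_less_Suc_iff)

lemma deg_less_SucE: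
  assumes "v \<in> deg_less (Suc n)"
  obtains b w where "b \<in> B" "w \<in> deg_less n" "v = b \<otimes> u [^] n \<oplus> w"
  using assms by (auto simp: deg_less_Suc_iff)

lemma deg_less_closed [simp]: "v \<in> deg_less n \<Longrightarrow> v \<in> carrier R"
  by (induction n arbitrary: v) (auto simp: deg_less_Suc_iff)

lemma deg_less_zero [simp]: "\<zero> \<in> deg_less n"
proof (induction n)
  case (Suc n)
  then show ?case using deg_less_SucI[of \<zero> \<zero> n] by simp
qed simp

lemma deg_less_1: "deg_less (Suc 0) = B"
  by (auto simp: deg_less_Suc_iff)

lemma deg_less_Suc_mono: "v \<in> deg_less n \<Longrightarrow> v \<in> deg_less (Suc n)"
  using deg_less_SucI[of \<zero> v n] by simp

lemma deg_less_mono: "v \<in> deg_less n \<Longrightarrow> n \<le> m \<Longrightarrow> v \<in> deg_less m"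
  using lift_Suc_mono_le[of deg_less n m] deg_less_Suc_mono by blast

lemma deg_less_add [simp]:
  "v \<in> deg_less n \<Longrightarrow> w \<in> deg_less n \<Longrightarrow> v \<oplus> w \<in> deg_less n"
proof (induction n arbitrary: v w)
  case (Suc n)
  obtain b v' c w' where *: "b \<in> B" "v' \<in> deg_less n" "v = b \<otimes> u [^] n \<oplus> v'"
    "c \<in> B" "w' \<in> deg_less n" "w = c \<otimes> u [^] n \<oplus> w'"
    using Suc.prems by (meson deg_less_SucE)
  then have "v \<oplus> w = (b \<oplus> c) \<otimes> u [^] n \<oplus> (v' \<oplus> w')"
    by (simp add: l_distr a_ac)
  then show ?case
    using * Suc.IH deg_less_SucI by simp
qed simp

lemma deg_less_smult [simp]: "b \<in> B \<Longrightarrow> v \<in> deg_less n \<Longrightarrow> b \<otimes> v \<in> deg_less n"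
proof (induction n arbitrary: v)
  case (Suc n)
  obtain c v' where *: "c \<in> B" "v' \<in> deg_less n" "v = c \<otimes> u [^] n \<oplus> v'"
    using Suc.prems by (meson deg_less_SucE)
  then have "b \<otimes> v = (b \<otimes> c) \<otimes> u [^] n \<oplus> b \<otimes> v'"
    using Suc.prems by (simp add: r_distr m_assoc)
  then show ?case
    using * Suc deg_less_SucI by simp
qed simp

lemma deg_less_minus [simp]: "v \<in> deg_less n \<Longrightarrow> \<ominus> v \<in> deg_less n"
  using deg_less_smult[of "\<ominus> \<one>" v n] by (simp add: l_minus)

lemma deg_less_diff [simp]:
  "v \<in> deg_less n \<Longrightarrow> w \<in> deg_less n \<Longrightarrow> v \<ominus> w \<in> deg_less n"
  by (simp add: a_minus_def)

lemma deg_less_shift: "v \<in> deg_less n \<Longrightarrow> u \<otimes> v \<in> deg_less (Suc n)"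
proof (induction n arbitrary: v)
  case (Suc n)
  obtain c w where *: "c \<in> B" "w \<in> deg_less n" "v = c \<otimes> u [^] n \<oplus> w"
    using Suc.prems by (meson deg_less_SucE)
  then have "u \<otimes> v = c \<otimes> u [^] Suc n \<oplus> u \<otimes> w"
    by (simp add: r_distr m_ac)
  then show ?case
    using deg_less_SucI[OF *(1) Suc.IH[OF *(2)]] by simp
qed simp

lemma deg_less_shift_pow: "v \<in> deg_less n \<Longrightarrow> u [^] j \<otimes> v \<in> deg_less (n + j)"
proof (induction j)
  case (Suc j)
  then have "u \<otimes> (u [^] j \<otimes> v) \<in> deg_less (Suc (n + j))"
    by (intro deg_less_shift) simp
  moreover have "u \<otimes> (u [^] j \<otimes> v) = u [^] Suc j \<otimes> v"
    using Suc.prems by (simp add: m_ac)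
  ultimately show ?case by simp
qed simp

lemma deg_less_mult: "v \<in> deg_less m \<Longrightarrow> w \<in> deg_less n \<Longrightarrow> v \<otimes> w \<in> deg_less (m + n)"
proof (induction m arbitrary: v)
  case (Suc m)
  obtain b v' where *: "b \<in> B" "v' \<in> deg_less m" "v = b \<otimes> u [^] m \<oplus> v'"
    using Suc.prems by (meson deg_less_SucE)
  then have "v \<otimes> w = b \<otimes> (u [^] m \<otimes> w) \<oplus> v' \<otimes> w"
    using Suc.prems by (simp add: l_distr m_assoc)
  moreover have "u [^] m \<otimes> w \<in> deg_less (m + n)" "v' \<otimes> w \<in> deg_less (m + n)"
    using * Suc deg_less_shift_pow[of w n m] by (auto simp: add.commute)
  ultimately show ?case
    using * deg_less_Suc_mono by simp
qed simp

lemma simple_extension_eq: "simple_extension B u = (\<Union>n. deg_less n)"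
proof (intro equalityI subsetI)
  fix v assume "v \<in> simple_extension B u"
  then show "v \<in> (\<Union>n. deg_less n)"
  proof induction
    case (lin v b)
    then obtain n where "v \<in> deg_less n" by auto
    then have "v \<otimes> u \<in> deg_less (Suc n)"
      using deg_less_shift[of v n] m_comm[of v u] by simp
    moreover have "b \<in> deg_less (Suc n)"
      using lin deg_less_1 deg_less_mono[of b "Suc 0" "Suc n"] by auto
    ultimately show ?case by (intro UN_I[of "Suc n"]) auto
  qed (auto intro: exI[of _ 0])
next
  fix v assume "v \<in> (\<Union>n. deg_less n)"
  then obtain p where p: "set p \<subseteq> B" "v = eval p u" by (auto simp: deg_less_def)
  interpret S: subring "simple_extension B u" R
    by (rule simple_extension_is_subring[OF subring_B]) simp
  have "B \<subseteq> simple_extension B u" "u \<in> simple_extension B u"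
    using simple_extension_incl[of B u] simple_extension_mem[OF subring_B] subringE(1)[OF subring_B]
    by auto
  then have "eval p u \<in> simple_extension B u"
    using p(1) ring.eval_in_carrier[OF subring_is_ring[OF S.subring_axioms], of p u]
      eval_consistent[OF S.subring_axioms] by auto
  with p show "v \<in> simple_extension B u" by simp
qed

abbreviation "C \<equiv> simple_extension B u"

lemma subring_C: "subring C R"
  by (rule simple_extension_is_subring[OF subring_B]) simp

lemma C_closed [simp]: "v \<in> C \<Longrightarrow> v \<in> carrier R"
  using subringE(1)[OF subring_C] by blast

lemma C_ops [simp]:
  "\<one> \<in> C" "\<zero> \<in> C" "v \<in> C \<Longrightarrow> \<ominus> v \<in> C"
  "v \<in> C \<Longrightarrow> w \<in> C \<Longrightarrow> v \<oplus> w \<in> C"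
  "v \<in> C \<Longrightarrow> w \<in> C \<Longrightarrow> v \<ominus> w \<in> C"
  "v \<in> C \<Longrightarrow> w \<in> C \<Longrightarrow> v \<otimes> w \<in> C"
  using subringE[OF subring_C] by (auto simp: a_minus_def)

lemma C_pow [simp]: "v \<in> C \<Longrightarrow> v [^] (n::nat) \<in> C"
  by (induction n) auto

lemma B_in_C [simp]: "b \<in> B \<Longrightarrow> b \<in> C"
  unfolding simple_extension_eq using deg_less_1 by blast

lemma deg_less_in_C [simp]: "v \<in> deg_less n \<Longrightarrow> v \<in> C"
  unfolding simple_extension_eq by blast

lemma u_in_C [simp]: "u \<in> C"
  by (rule simple_extension_mem[OF subring_B]) simp

text \<open>A shortest representation has a nonzero leading coefficient, since otherwise its tail
  would be a shorter one.\<close>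

lemma leading_term:
  assumes "v \<in> C" "v \<noteq> \<zero>"
  obtains m b w where "b \<in> B" "b \<noteq> \<zero>" "w \<in> deg_less m" "v = b \<otimes> u [^] m \<oplus> w"
proof -
  have "\<exists>n. v \<in> deg_less n" using assms(1) by (auto simp: simple_extension_eq)
  then obtain n where n: "v \<in> deg_less n" and least: "\<And>m. m < n \<Longrightarrow> v \<notin> deg_less m"
    using exists_least_iff[of "\<lambda>n. v \<in> deg_less n"] by blast
  with assms(2) obtain m where m: "n = Suc m" by (cases n) auto
  with n obtain b w where bw: "b \<in> B" "w \<in> deg_less m" "v = b \<otimes> u [^] m \<oplus> w"
    by (meson deg_less_SucE)
  moreover have "b \<noteq> \<zero>" using bw least[of m] m by auto
  ultimately show thesis using that by blast
qed

text \<open>\<open>\<one> \<oplus> t\<close> is coprime to \<open>t\<close>: from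
  \<open>(\<one> \<oplus> t) \<otimes> h = t [^] Suc n\<close> the cofactor
  \<open>t [^] n \<ominus> h\<close> yields \<open>t [^] n\<close>, so the exponent drops to
  zero.\<close>

lemma dvd_one_of_dvd_pow:
  assumes "t \<in> C" "h \<in> C" "(\<one> \<oplus> t) \<otimes> h = t [^] (n::nat)"
  shows "\<exists>g \<in> C. (\<one> \<oplus> t) \<otimes> g = \<one>"
  using assms(2,3)
proof (induction n arbitrary: h)
  case (Suc n)
  have ring: "(\<one> \<oplus> x) \<otimes> (y \<ominus> z) = (y \<oplus> y \<otimes> x) \<ominus> (\<one> \<oplus> x) \<otimes> z"
      "(y \<oplus> x) \<ominus> x = y"
    if "x \<in> carrier R" "y \<in> carrier R" "z \<in> carrier R" for x y z
    using that by algebra+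
  have "(\<one> \<oplus> t) \<otimes> (t [^] n \<ominus> h) = (t [^] n \<oplus> t [^] Suc n) \<ominus> (\<one> \<oplus> t) \<otimes> h"
    using ring(1) C_closed[OF assms(1)] C_closed[OF Suc.prems(1)] by simp
  also have "\<dots> = t [^] n"
    using ring(2)[of "t [^] Suc n" "t [^] n"] C_closed[OF assms(1)] Suc.prems(2) by auto
  finally show ?case
    using assms(1) Suc.prems(1) by (intro Suc.IH[of "t [^] n \<ominus> h"]) simp_all
qed auto

text \<open>If \<open>u\<close> were transcendental over \<open>B\<close>, then \<open>1 + u f\<close> could only divide a power of \<open>f\<close>
  by being a unit, which its degree forbids.\<close>

lemma G_subring_dependent:
  assumes "G_subring C"
  obtains n b where "b \<in> B" "b \<noteq> \<zero>" "b \<otimes> u [^] n \<in> deg_less n"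
proof (rule ccontr)
  assume neg: "\<not> thesis"
  have indep: "b = \<zero>" if "b \<in> B" "b \<otimes> u [^] n \<in> deg_less n" for b n
    using that neg \<open>\<And>b n. \<lbrakk>b \<in> B; b \<noteq> \<zero>; b \<otimes> u [^] n \<in> deg_less n\<rbrakk> \<Longrightarrow> thesis\<close> by blast
  \<comment> \<open>With no relation available, a sum with a nonzero leading coefficient cannot
    vanish: this is transcendence in the form used below.\<close>
  have lead: "b \<otimes> u [^] n \<oplus> v = \<zero> \<Longrightarrow> b = \<zero>" if "b \<in> B" "v \<in> deg_less n" for b v n
  proof (rule indep[OF that(1)])
    assume "b \<otimes> u [^] n \<oplus> v = \<zero>"
    then have "b \<otimes> u [^] n = \<ominus> v"
      using that by (simp add: sum_zero_eq_neg)
    with that show "b \<otimes> u [^] n \<in> deg_less n" by simp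
  qed
  obtain f where f: "f \<in> C" "f \<noteq> \<zero>"
    and G: "\<And>a. a \<in> C \<Longrightarrow> a \<noteq> \<zero> \<Longrightarrow> \<exists>g \<in> C. \<exists>n::nat. a \<otimes> g = f [^] n"
    using assms unfolding G_subring_def by blast
  obtain m b w where bw: "b \<in> B" "b \<noteq> \<zero>" "w \<in> deg_less m" "f = b \<otimes> u [^] m \<oplus> w"
    using leading_term[OF f] by blast
  \<comment> \<open>The factor \<open>u\<close> gives \<open>\<one> \<oplus> t\<close> positive
    degree even when \<open>f\<close> lies in \<open>B\<close>.\<close>
  define t where "t = u \<otimes> f"
  have one: "\<one> \<in> deg_less (Suc m)" 
    using deg_less_mono[of \<one> "Suc 0" "Suc m"] by (simp add: deg_less_1)
  have t: "\<one> \<oplus> t = b \<otimes> u [^] Suc m \<oplus> (\<one> \<oplus> u \<otimes> w)"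
    using bw by (simp add: t_def r_distr m_ac a_ac)
  have w': "\<one> \<oplus> u \<otimes> w \<in> deg_less (Suc m)"
    using bw one deg_less_shift by simp
  have tC: "t \<in> C" using f by (simp add: t_def)
  have "\<one> \<oplus> t \<noteq> \<zero>"
    using lead[OF bw(1) w'] t bw(2) by auto
  then obtain h n where h: "h \<in> C" "(\<one> \<oplus> t) \<otimes> h = f [^] (n::nat)"
    using G[of "\<one> \<oplus> t"] tC by auto
  \<comment> \<open>The factor \<open>u [^] n\<close> turns \<open>f [^] n\<close> into
    \<open>t [^] n\<close>, so that powers of \<open>t\<close> can be stripped.\<close>
  have "(\<one> \<oplus> t) \<otimes> (u [^] n \<otimes> h) = u [^] n \<otimes> ((\<one> \<oplus> t) \<otimes> h)"
    using h(1) tC by (simp add: m_ac)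
  also have "\<dots> = t [^] n"
    unfolding h(2) using f by (simp add: t_def nat_pow_distrib)
  finally obtain g where g: "g \<in> C" "(\<one> \<oplus> t) \<otimes> g = \<one>"
    using dvd_one_of_dvd_pow[of t "u [^] n \<otimes> h" n] tC h(1) by auto
  then have "g \<noteq> \<zero>" using tC by auto
  then obtain j c z where cz: "c \<in> B" "c \<noteq> \<zero>" "z \<in> deg_less j" "g = c \<otimes> u [^] j \<oplus> z"
    using leading_term[OF g(1)] by blast
  \<comment> \<open>All terms of \<open>(\<one> \<oplus> t) \<otimes> g\<close> other than the top
    one, whose coefficient is \<open>b \<otimes> c\<close>.\<close>
  define l where "l = b \<otimes> (u [^] Suc m \<otimes> z) \<oplus> c \<otimes> (u [^] j \<otimes> (\<one> \<oplus> u \<otimes> w)) \<oplus> (\<one> \<oplus> u \<otimes> w) \<otimes> z"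
  have "u [^] Suc m \<otimes> z \<in> deg_less (Suc m + j)"
    using deg_less_shift_pow[OF cz(3), of "Suc m"] by (simp only: add.commute)
  moreover have "u [^] j \<otimes> (\<one> \<oplus> u \<otimes> w) \<in> deg_less (Suc m + j)"
    using deg_less_shift_pow[OF w', of j] .
  ultimately have l: "l \<in> deg_less (Suc m + j)"
    unfolding l_def using deg_less_mult[OF w' cz(3)] bw(1) cz(1)
    by (metis deg_less_add deg_less_smult)
  have pow: "u [^] (Suc m + j) = u [^] Suc m \<otimes> u [^] j"
    using nat_pow_mult u_closed by metis
  have um: "u [^] Suc m \<in> carrier R" "u [^] j \<in> carrier R" by auto
  have expand: "(b \<otimes> x \<oplus> w') \<otimes> (c \<otimes> y \<oplus> z)
      = (b \<otimes> c) \<otimes> (x \<otimes> y) \<oplus> (b \<otimes> (x \<otimes> z) \<oplus> c \<otimes> (y \<otimes> w') \<oplus> w' \<otimes> z)"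
    if "b \<in> carrier R" "c \<in> carrier R" "x \<in> carrier R" "y \<in> carrier R" "z \<in> carrier R"
      "w' \<in> carrier R" for b c x y z w'
    using that by algebra
  have "(\<one> \<oplus> t) \<otimes> g = (b \<otimes> c) \<otimes> u [^] (Suc m + j) \<oplus> l"
    unfolding t cz(4) l_def pow
    by (rule expand) (use bw cz w' um in simp_all)
  then have one_eq: "\<one> = (b \<otimes> c) \<otimes> u [^] (Suc m + j) \<oplus> l"
    using g(2) by simp
  have ring: "x \<oplus> (y \<ominus> z) = \<zero>"
    if "z = x \<oplus> y" "x \<in> carrier R" "y \<in> carrier R" for x y z
    using that by algebra
  \<comment> \<open>Because \<open>Suc m + j\<close> is positive, \<open>\<one>\<close> counts among
    the lower terms.\<close>
  have "(b \<otimes> c) \<otimes> u [^] (Suc m + j) \<oplus> (l \<ominus> \<one>) = \<zero>"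
    by (rule ring[OF one_eq]) (use l bw(1) cz(1) in simp_all)
  moreover have "l \<ominus> \<one> \<in> deg_less (Suc m + j)"
    using l one deg_less_mono[OF one, of "Suc m + j"] by simp
  ultimately have "b \<otimes> c = \<zero>"
    using lead[of "b \<otimes> c" "l \<ominus> \<one>" "Suc m + j"] bw cz by simp
  then show False
    using bw cz by (auto simp: integral_iff)
qed

text \<open>As long as the degree is at least \<open>d\<close>, one multiplication by
  \<open>a\<close> lets the relation replace the leading power of \<open>u\<close> by lower
  ones.\<close>

lemma reduce_by_relation:
  assumes a: "a \<in> B" "a \<otimes> u [^] d \<in> deg_less d" and v: "v \<in> deg_less n"
  shows "\<exists>N::nat. a [^] N \<otimes> v \<in> deg_less d"
  using v
proof (induction n arbitrary: v)
  case 0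
  then show ?case using a(1) by simp
next
  case (Suc n)
  show ?case
  proof (cases "d \<le> n")
    case False
    then have "v \<in> deg_less d" using Suc.prems deg_less_mono[of v "Suc n" d] by simp
    then show ?thesis by (intro exI[of _ 0]) simp
  next
    case True
    obtain b w where bw: "b \<in> B" "w \<in> deg_less n" "v = b \<otimes> u [^] n \<oplus> w"
      using Suc.prems by (meson deg_less_SucE)
    have "u [^] n = u [^] (n - d) \<otimes> u [^] d"
      using True nat_pow_mult[of u "n - d" d] by simp
    then have "a \<otimes> v = b \<otimes> (u [^] (n - d) \<otimes> (a \<otimes> u [^] d)) \<oplus> a \<otimes> w"
      using a(1) bw by (simp add: r_distr m_ac)
    moreover have "u [^] (n - d) \<otimes> (a \<otimes> u [^] d) \<in> deg_less n"
      using deg_less_shift_pow[OF a(2), of "n - d"] True by simp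
    ultimately have "a \<otimes> v \<in> deg_less n" using a(1) bw by simp
    then obtain N :: nat where "a [^] N \<otimes> (a \<otimes> v) \<in> deg_less d" using Suc.IH by blast
    then have "a [^] Suc N \<otimes> v \<in> deg_less d"
      using a(1) Suc.prems by (simp add: m_assoc)
    then show ?thesis by blast
  qed
qed

text \<open>Euclidean division in which multiplying the dividend by \<open>b\<close> replaces
  dividing by the leading coefficient \<open>b\<close>. Only representations enter, so it holds for
  algebraic \<open>u\<close> as well.\<close>

lemma pseudo_division:
  assumes "b \<in> B" "w' \<in> deg_less m" "z \<in> deg_less (m + j)"
  shows "\<exists>N::nat. \<exists>h \<in> deg_less j. b [^] N \<otimes> z \<ominus> h \<otimes> (b \<otimes> u [^] m \<oplus> w') \<in> deg_less m"
  using assms(3)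
proof (induction j arbitrary: z)
  case 0
  then show ?case using assms by (intro exI[of _ 0] bexI[of _ \<zero>]) (simp_all add: minus_eq)
next
  case (Suc j)
  obtain t z' where t: "t \<in> B" "z' \<in> deg_less (m + j)" "z = t \<otimes> u [^] (m + j) \<oplus> z'"
    using Suc.prems by (metis add_Suc_right deg_less_SucE)
  define w where "w = b \<otimes> u [^] m \<oplus> w'"
  have w: "w \<in> carrier R" using assms by (simp add: w_def)
  have pow: "u [^] (m + j) = u [^] m \<otimes> u [^] j" by (simp add: nat_pow_mult)
  have ring: "b \<otimes> (t \<otimes> (x \<otimes> y) \<oplus> z') \<ominus> (t \<otimes> y) \<otimes> (b \<otimes> x \<oplus> w') = b \<otimes> z' \<ominus> t \<otimes> (y \<otimes> w')"
    if "b \<in> carrier R" "t \<in> carrier R" "x \<in> carrier R" "y \<in> carrier R" "z' \<in> carrier R"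
      "w' \<in> carrier R" for b t x y z' w'
    using that by algebra
  have "b \<otimes> z \<ominus> (t \<otimes> u [^] j) \<otimes> w = b \<otimes> z' \<ominus> t \<otimes> (u [^] j \<otimes> w')"
    unfolding t(3) w_def pow using t assms by (intro ring) simp_all
  moreover have "u [^] j \<otimes> w' \<in> deg_less (m + j)"
    using deg_less_shift_pow assms(2) by simp
  ultimately have "b \<otimes> z \<ominus> (t \<otimes> u [^] j) \<otimes> w \<in> deg_less (m + j)"
    using t assms by simp
  then obtain N :: nat and h where h: "h \<in> deg_less j"
    "b [^] N \<otimes> (b \<otimes> z \<ominus> (t \<otimes> u [^] j) \<otimes> w) \<ominus> h \<otimes> w \<in> deg_less m"
    using Suc.IH unfolding w_def by blast
  have ring2: "p \<otimes> (b \<otimes> z \<ominus> (t \<otimes> y) \<otimes> w) \<ominus> h \<otimes> w = (p \<otimes> b) \<otimes> z \<ominus> ((p \<otimes> t) \<otimes> y \<oplus> h) \<otimes> w"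
    if "p \<in> carrier R" "b \<in> carrier R" "z \<in> carrier R" "t \<in> carrier R" "y \<in> carrier R"
      "w \<in> carrier R" "h \<in> carrier R" for p b z t y w h
    using that by algebra
  have "b [^] Suc N \<otimes> z \<ominus> ((b [^] N \<otimes> t) \<otimes> u [^] j \<oplus> h) \<otimes> w
      = b [^] N \<otimes> (b \<otimes> z \<ominus> (t \<otimes> u [^] j) \<otimes> w) \<ominus> h \<otimes> w"
    using ring2[of "b [^] N" b z t "u [^] j" w h] assms t(1) Suc.prems h(1) w by simp
  moreover have "(b [^] N \<otimes> t) \<otimes> u [^] j \<oplus> h \<in> deg_less (Suc j)"
    using assms t h by (intro deg_less_SucI) simp_all
  ultimately show ?case
    using h(2) unfolding w_def by metis
qed

text \<open>The relation of least degree \<open>d\<close> for \<open>u\<close> over \<open>B\<close>, with leading coefficient \<open>a\<close>, makes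
  \<open>B[u]\<close> after inverting \<open>a\<close> free with basis \<open>1, \<dots>, u\<^sup>d\<^sup>-\<^sup>1\<close>. Comparing constant coefficients carries
  divisibility from \<open>B[u]\<close> down to \<open>B\<close>; and \<open>f\<close> has a nonzero multiple \<open>w\<close> in \<open>B\<close>,
  namely one of least degree.\<close>

lemma G_subring_descends:
  assumes "G_subring C"
  shows "G_subring B"
proof -
  let ?P = "\<lambda>d. \<exists>a \<in> B - {\<zero>}. a \<otimes> u [^] d \<in> deg_less d"
  obtain d where "?P d" and least_d: "\<And>m. m < d \<Longrightarrow> \<not> ?P m"
    using G_subring_dependent[OF assms] exists_least_iff[of ?P] by (metis Diff_iff singletonD)
  then obtain a where a: "a \<in> B" "a \<noteq> \<zero>" "a \<otimes> u [^] d \<in> deg_less d" by auto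
  have d: "d > 0" using a by (cases d) auto
  \<comment> \<open>Below degree \<open>d\<close> there is no relation. Hence
    \<open>e \<otimes> w \<in> B\<close> forces the coefficients of \<open>w\<close> at the positive
    powers of \<open>u\<close> to vanish.\<close>
  have indep: "w \<in> B" if "e \<in> B" "e \<noteq> \<zero>" "e \<otimes> w \<in> B" "w \<in> deg_less n" "n \<le> d" for e w n
    using that(4,5,3)
  proof (induction n arbitrary: w)
    case 0
    then show ?case by simp
  next
    case (Suc n)
    obtain b w' where bw: "b \<in> B" "w' \<in> deg_less n" "w = b \<otimes> u [^] n \<oplus> w'"
      using Suc.prems(1) by (meson deg_less_SucE)
    show ?case
    proof (cases "n = 0")
      case True
      then show ?thesis using Suc.prems deg_less_1 by simp
    next
      case False
      have ring: "(e \<otimes> b) \<otimes> x = e \<otimes> (b \<otimes> x \<oplus> w') \<ominus> e \<otimes> w'"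
        if "e \<in> carrier R" "b \<in> carrier R" "x \<in> carrier R" "w' \<in> carrier R" for e b x w'
        using that by algebra
      have "(e \<otimes> b) \<otimes> u [^] n = e \<otimes> w \<ominus> e \<otimes> w'"
        unfolding bw(3) using bw that(1) by (intro ring) simp_all
      moreover have "e \<otimes> w \<in> deg_less n"
        using Suc.prems(3) False deg_less_1 deg_less_mono[of _ "Suc 0" n] by auto
      ultimately have "(e \<otimes> b) \<otimes> u [^] n \<in> deg_less n"
        using bw that(1) by simp
      then have "e \<otimes> b = \<zero>"
        using least_d[of n] Suc.prems(2) that(1) bw(1) by auto
      then have "b = \<zero>" using that(1,2) bw(1) by (auto simp: integral_iff)
      then have "w = w'" using bw by simp
      then show ?thesis using Suc bw by simp
    qed
  qed
  obtain f where f: "f \<in> C" "f \<noteq> \<zero>"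
    and G: "\<And>a. a \<in> C \<Longrightarrow> a \<noteq> \<zero> \<Longrightarrow> \<exists>g \<in> C. \<exists>n::nat. a \<otimes> g = f [^] n"
    using assms unfolding G_subring_def by blast
  \<comment> \<open>Some nonzero multiple of \<open>f\<close> has degree at most \<open>m\<close>;
    the strict bound of \<open>deg_less\<close> accounts for the \<open>Suc\<close>.\<close>
  let ?Q = "\<lambda>m. \<exists>w \<in> deg_less (Suc m). w \<noteq> \<zero> \<and> (\<exists>g \<in> C. w = f \<otimes> g)"
  obtain n where "f \<in> deg_less n" using f(1) by (auto simp: simple_extension_eq)
  then have "?Q n"
    using f deg_less_Suc_mono by (intro bexI[of _ f]) (auto intro!: bexI[of _ \<one>])
  then obtain m where "?Q m" and least_m: "\<And>i. i < m \<Longrightarrow> \<not> ?Q i"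
    using exists_least_iff[of ?Q] by blast
  then obtain w g0 where w: "w \<in> deg_less (Suc m)" "w \<noteq> \<zero>" and g0: "g0 \<in> C" "w = f \<otimes> g0"
    by blast
  have least_m': "v = \<zero>" if "v \<in> deg_less m" "g \<in> C" "v = f \<otimes> g" for v g
    using that least_m[of "m - 1"] by (cases m) auto
  \<comment> \<open>For positive \<open>m\<close>, pseudo-dividing
    \<open>a \<otimes> u [^] (d - m) \<otimes> w\<close> by \<open>w\<close> leaves a multiple of
    \<open>f\<close> of degree below \<open>m\<close>, hence zero. Cancelling \<open>w\<close> then
    gives a relation for \<open>u\<close> of degree \<open>d - m\<close>, which is smaller than
    \<open>d\<close>.\<close>
  have "m = 0"
  proof (rule ccontr)
    assume "m \<noteq> 0"
    obtain b w' where bw: "b \<in> B" "w' \<in> deg_less m" "w = b \<otimes> u [^] m \<oplus> w'"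
      using w by (meson deg_less_SucE)
    have b: "b \<noteq> \<zero>"
    proof
      assume "b = \<zero>"
      then have "w \<in> deg_less m" using bw by simp
      then show False using least_m' g0 w(2) by blast
    qed
    \<comment> \<open>Otherwise reducing \<open>w\<close> by the relation would produce a nonzero
      multiple of \<open>f\<close> of degree below \<open>d \<le> m\<close>.\<close>
    have "m < d"
    proof (rule ccontr)
      assume "\<not> m < d"
      obtain N :: nat where N: "a [^] N \<otimes> w \<in> deg_less d"
        using reduce_by_relation[OF a(1,3) w(1)] by blast
      then have "a [^] N \<otimes> w \<in> deg_less m" using deg_less_mono \<open>\<not> m < d\<close> by simp
      then have "a [^] N \<otimes> w = \<zero>"
        using a(1) f(1) g0 by (intro least_m'[of _ "a [^] N \<otimes> g0"]) (simp_all add: m_lcomm)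
      then show False
        using integral[of "a [^] N" w] w pow_nonzero[of a N] a by simp
    qed
    \<comment> \<open>The formal degree of \<open>z\<close> is \<open>d\<close>, but its top term
      \<open>b \<otimes> (a \<otimes> u [^] d)\<close> is lowered by the relation. So
      \<open>z\<close> has degree below \<open>d = m + (d - m)\<close>, as the division
      requires.\<close>
    define z where "z = (a \<otimes> u [^] (d - m)) \<otimes> w"
    have pow: "u [^] d = u [^] (d - m) \<otimes> u [^] m"
      using \<open>m < d\<close> nat_pow_mult[of u "d - m" m] by simp
    have ring: "(a \<otimes> x) \<otimes> (b \<otimes> y \<oplus> w') = b \<otimes> (a \<otimes> (x \<otimes> y)) \<oplus> a \<otimes> (x \<otimes> w')"
      if "a \<in> carrier R" "b \<in> carrier R" "x \<in> carrier R" "y \<in> carrier R" "w' \<in> carrier R"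
      for a b x y w'
      using that by algebra
    have "z = b \<otimes> (a \<otimes> u [^] d) \<oplus> a \<otimes> (u [^] (d - m) \<otimes> w')"
      unfolding z_def bw(3) pow using bw a by (intro ring) simp_all
    moreover have "u [^] (d - m) \<otimes> w' \<in> deg_less d"
      using deg_less_shift_pow[OF bw(2), of "d - m"] \<open>m < d\<close> by simp
    ultimately have "z \<in> deg_less (m + (d - m))"
      using a bw \<open>m < d\<close> by simp
    then obtain N :: nat and h where h: "h \<in> deg_less (d - m)" "b [^] N \<otimes> z \<ominus> h \<otimes> w \<in> deg_less m"
      using pseudo_division[OF bw(1,2)] bw(3) by blast
    define y where "y = (b [^] N \<otimes> a) \<otimes> u [^] (d - m) \<ominus> h"
    have y: "y \<in> C" using bw(1) a(1) h(1) by (simp add: y_def)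
    have ring': "p \<otimes> ((a \<otimes> x) \<otimes> w) \<ominus> h \<otimes> w = w \<otimes> ((p \<otimes> a) \<otimes> x \<ominus> h)"
      if "p \<in> carrier R" "a \<in> carrier R" "x \<in> carrier R" "w \<in> carrier R" "h \<in> carrier R"
      for p a x w h
      using that by algebra
    have yw: "b [^] N \<otimes> z \<ominus> h \<otimes> w = w \<otimes> y"
      unfolding z_def y_def using bw(1) a(1) w(1) h(1) by (intro ring') simp_all
    have "w \<otimes> y = f \<otimes> (g0 \<otimes> y)"
      using f(1) g0 y by (simp add: m_assoc)
    then have "w \<otimes> y = \<zero>"
      using h(2) y g0(1) unfolding yw by (intro least_m'[of _ "g0 \<otimes> y"]) simp_all
    then have "y = \<zero>" using integral[of w y] w y by simp
    then have "(b [^] N \<otimes> a) \<otimes> u [^] (d - m) = h"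
      using bw(1) a(1) h(1) by (simp add: y_def)
    then have "b [^] N \<otimes> a = \<zero>"
      using least_d[of "d - m"] h(1) bw(1) a(1) \<open>m < d\<close> \<open>m \<noteq> 0\<close> by auto
    then show False
      using a pow_nonzero[of b N] b bw(1) by (auto simp: integral_iff)
  qed
  then have wB: "w \<in> B" using w deg_less_1 by simp
  \<comment> \<open>The witness for \<open>B\<close> is \<open>a \<otimes> w\<close>:
    \<open>w\<close> replaces \<open>f\<close> by an element of \<open>B\<close>, and powers of
    \<open>a\<close> pay for reducing the cofactor below degree \<open>d\<close>, where it is forced
    into \<open>B\<close>.\<close>
  have "\<exists>g \<in> B. \<exists>n::nat. e \<otimes> g = (a \<otimes> w) [^] n" if e: "e \<in> B" "e \<noteq> \<zero>" for e
  proof -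
    obtain g and n :: nat where g: "g \<in> C" "e \<otimes> g = f [^] n" using G[of e] e by auto
    have eg: "e \<otimes> (g \<otimes> g0 [^] n) = w [^] n"
      using g g0 e f(1) by (simp add: m_assoc[symmetric] nat_pow_distrib)
    have "g \<otimes> g0 [^] n \<in> C" using g(1) g0(1) by simp
    then obtain k where "g \<otimes> g0 [^] n \<in> deg_less k" by (auto simp: simple_extension_eq)
    then obtain N :: nat where N: "a [^] N \<otimes> (g \<otimes> g0 [^] n) \<in> deg_less d"
      using reduce_by_relation[OF a(1,3)] by blast
    define c where "c = a [^] N \<otimes> (g \<otimes> g0 [^] n)"
    have ring: "x \<otimes> (y \<otimes> z) = y \<otimes> (x \<otimes> z)"
      if "x \<in> carrier R" "y \<in> carrier R" "z \<in> carrier R" for x y z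
      using that by algebra
    have ec: "e \<otimes> c = a [^] N \<otimes> w [^] n"
      unfolding c_def eg[symmetric] using a e g g0 by (intro ring) simp_all
    then have "c \<in> B"
      using indep[of e c d] e a(1) wB N by (simp add: c_def)
    \<comment> \<open>The extra factor evens out the exponents \<open>N\<close> of \<open>a\<close>
      and \<open>n\<close> of \<open>w\<close>, so that a power of the single element
      \<open>a \<otimes> w\<close> results.\<close>
    have "e \<otimes> (c \<otimes> (a [^] n \<otimes> w [^] N)) = (e \<otimes> c) \<otimes> (a [^] n \<otimes> w [^] N)"
      using e \<open>c \<in> B\<close> a(1) wB by (simp add: m_assoc)
    also have "\<dots> = (a [^] N \<otimes> a [^] n) \<otimes> (w [^] n \<otimes> w [^] N)"
      unfolding ec using a(1) wB by (simp add: m_ac)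
    also have "\<dots> = (a \<otimes> w) [^] (N + n)"
      using a(1) wB by (simp add: nat_pow_mult nat_pow_distrib add.commute)
    finally show ?thesis
      using \<open>c \<in> B\<close> a(1) wB by (intro bexI[of _ "c \<otimes> (a [^] n \<otimes> w [^] N)"]) auto
  qed
  moreover have "a \<otimes> w \<in> B - {\<zero>}" using a wB w by (auto simp: integral_iff)
  ultimately show ?thesis unfolding G_subring_def by (metis Diff_iff singletonI)
qed

lemma G_subring_algebraic:
  assumes "G_subring C"
  shows "(algebraic over B) u"
proof -
  obtain n b where b: "b \<in> B" "b \<noteq> \<zero>" "b \<otimes> u [^] n \<in> deg_less n"
    using G_subring_dependent[OF assms] by blast
  then have "\<ominus> (b \<otimes> u [^] n) \<in> deg_less n" by simp
  then obtain p where p: "set p \<subseteq> B" "length p = n" "eval p u = \<ominus> (b \<otimes> u [^] n)"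
    by (auto simp: deg_less_def)
  show ?thesis
  proof (rule algebraicI)
    show "b # p \<in> carrier (B[X])" using b p by (simp add: univ_poly_carrier[symmetric] polynomial_def)
    show "eval (b # p) u = \<zero>" using b p by (simp add: r_neg)
  qed simp
qed

end

section \<open>Zariski's lemma for G-domains\<close>

lemma (in domain) finite_extension_G_subring_algebraic:
  assumes K: "subfield K R" and "set xs \<subseteq> carrier R" and "G_subring (finite_extension K xs)"
    and "x \<in> set xs"
  shows "(algebraic over K) x"
  using assms(2-4)
proof (induction xs arbitrary: x)
  case (Cons y xs)
  let ?E = "finite_extension K xs"
  note subring_K = subfieldE(1)[OF K]
  have xs: "set xs \<subseteq> carrier R" and y: "y \<in> carrier R" using Cons.prems by auto
  interpret adjoined_element R ?E y
    by (rule adjoined_element.intro[OF domain_axioms adjoined_element_axioms.intro[OF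
          finite_extension_is_subring[OF subring_K xs] y]])
  have C: "G_subring C" using Cons.prems(2) by simp
  \<comment> \<open>Descent passes the property to \<open>?E\<close>, which by induction is a
    finite-dimensional field over \<open>K\<close>. The generator \<open>y\<close> is then algebraic
    over a field, and dimensions multiply along the tower.\<close>
  have alg: "(algebraic over K) z" if "z \<in> set xs" for z
    using Cons.IH[OF xs G_subring_descends[OF C] that] .
  have E: "subfield ?E R" "finite_dimension K ?E"
    using finite_extension_is_subfield[OF K xs alg] finite_extension_finite_dimension(1)[OF K xs alg]
    by auto
  have "finite_dimension ?E C"
    using finite_dimension_simple_extension[OF E(1) y] G_subring_algebraic[OF C] by simp
  then have "finite_dimension K C"
    using telescopic_base_dim(1)[OF K E] by simp
  moreover have "x \<in> C"
    using Cons.prems(1,3) finite_extension_mem[OF subring_K, of "y # xs"] by auto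
  ultimately show ?case
    using finite_dimension_imp_algebraic[OF K subring_C] by blast
qed simp

lemma (in ring) finite_extension_eq_carrier:
  assumes "domain R" "subring K R" "set xs \<subseteq> carrier R"
    and "generate_ring R (K \<union> set xs) = carrier R"
  shows "finite_extension K xs = carrier R"
proof
  note sub = domain.finite_extension_is_subring[OF assms(1-3)]
  show "finite_extension K xs \<subseteq> carrier R" using subringE(1)[OF sub] .
  have "K \<union> set xs \<subseteq> finite_extension K xs"
    using finite_extension_incl[OF subringE(1)[OF assms(2)] assms(3)]
      domain.finite_extension_mem[OF assms(1-3)] by simp
  then have "generate_ring R (K \<union> set xs) \<subseteq> finite_extension K xs"
    using subringE(1)[OF assms(2)] assms(3) by (intro generate_ring_min_subring1[OF _ sub]) simp_all
  then show "carrier R \<subseteq> finite_extension K xs" using assms(4) by simp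
qed

text \<open>Zariski's lemma with "field" weakened to "G-domain"; a field has the property with
  witness \<open>\<one>\<close>.\<close>

lemma (in domain) finitely_generated_algebraic:
  assumes K: "subfield K R" and xs: "finite S" "S \<subseteq> carrier R"
    and gen: "generate_ring R (K \<union> S) = carrier R"
    and G: "G_subring (carrier R)" and x: "x \<in> carrier R"
  shows "(algebraic over K) x"
proof -
  obtain xs where xs: "set xs = S" using xs(1) finite_list by blast
  have car: "set xs \<subseteq> carrier R" using xs assms(3) by simp
  have eq: "finite_extension K xs = carrier R"
    by (rule finite_extension_eq_carrier[OF domain_axioms subfieldE(1)[OF K] car])
       (simp add: gen xs)
  show ?thesis
    by (rule finite_extesion_mem_imp_algebraic[OF K car])
       (use finite_extension_G_subring_algebraic[OF K car] G x eq in simp_all)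
qed

lemma (in domain) algebraic_imp_field:
  assumes K: "subfield K R" and alg: "\<And>x. x \<in> carrier R \<Longrightarrow> (algebraic over K) x"
  shows "field R"
proof (rule cring_fieldI2)
  show "\<zero> \<noteq> \<one>" by simp
  fix x assume x: "x \<in> carrier R" "x \<noteq> \<zero>"
  then have "subfield (simple_extension K x) R"
    using simple_extension_is_subfield[OF K] alg by simp
  moreover have "x \<in> simple_extension K x"
    using simple_extension_mem[OF subfieldE(1)[OF K] x(1)] .
  ultimately show "\<exists>y \<in> carrier R. x \<otimes> y = \<one>"
    using subfield_m_inv[of "simple_extension K x" x] x subfieldE(3) by blast
qed

section \<open>Passage to the quotient by a prime ideal\<close>

lemma surjective_image_generate_ring:
  assumes h: "h \<in> ring_hom R A" and "ring R" "ring A" and surj: "h ` carrier R = carrier A"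
    and H: "H \<subseteq> carrier R" "generate_ring R H = carrier R"
  shows "generate_ring A (h ` H) = carrier A"
proof
  interpret R: ring R by fact
  interpret A: ring A by fact
  show "generate_ring A (h ` H) \<subseteq> carrier A"
    using A.generate_ring_incl[of "h ` H"] H(1) surj by blast
  have "h x \<in> generate_ring A (h ` H)" if "x \<in> generate_ring R H" for x
    using that
  proof induction
    case one
    then show ?case using generate_ring.one ring_hom_one[OF h] by metis
  next
    case (incl x)
    then show ?case by (auto intro: generate_ring.incl)
  next
    case (a_inv x)
    interpret ring_hom_ring R A h by (rule ring_hom_ringI2[OF R.ring_axioms A.ring_axioms h])
    show ?case using a_inv H(2) by (auto intro: generate_ring.a_inv)
  next
    case (eng_add x y)
    then show ?case using ring_hom_add[OF h] H(2) by (auto intro: generate_ring.eng_add)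
  next
    case (eng_mult x y)
    then show ?case using ring_hom_mult[OF h] H(2) by (auto intro: generate_ring.eng_mult)
  qed
  then show "carrier A \<subseteq> generate_ring A (h ` H)"
    unfolding H(2) surj[symmetric] by (rule image_subsetI)
qed

lemma (in ring) carrier_FactRing: "carrier (R Quot I) = (+>) I ` carrier R"
  unfolding FactRing_def A_RCOSETS_def' by auto

lemma (in ideal) coset_eq_zero_iff:
  assumes "x \<in> carrier R"
  shows "I +> x = \<zero>\<^bsub>R Quot I\<^esub> \<longleftrightarrow> x \<in> I"
  using rcos_const_imp_mem[OF assms] a_rcos_zero[OF ideal_axioms, of x]
  unfolding FactRing_def by auto

text \<open>The congruences assumed of \<open>f\<close> say that its coset witnesses the G-domain
  property of \<open>R Quot M\<close>; the generators of \<open>R\<close> are pushed to the quotient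
  along the projection.\<close>

lemma (in cring) quotient_finitely_generated_algebraic:
  assumes k: "field k" and \<phi>: "\<phi> \<in> ring_hom k R"
    and S: "finite S" "S \<subseteq> carrier R" "generate_ring R (\<phi> ` carrier k \<union> S) = carrier R"
    and M: "primeideal M R"
    and f: "f \<in> carrier R - M" "\<And>a. a \<in> carrier R - M \<Longrightarrow> \<exists>g \<in> carrier R. \<exists>n::nat. f [^] n \<ominus> a \<otimes> g \<in> M"
  shows "subfield ((\<lambda>c. M +> \<phi> c) ` carrier k) (R Quot M)"
    and "x \<in> carrier (R Quot M) \<Longrightarrow>
      (ring.algebraic (R Quot M) over ((\<lambda>c. M +> \<phi> c) ` carrier k)) x"
proof -
  interpret M: primeideal M R by fact
  interpret A: domain "R Quot M" by (rule M.quotient_is_domain)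
  interpret h: ring_hom_ring R "R Quot M" "(+>) M" by (rule M.rcos_ring_hom_ring)
  interpret k: field k by fact
  have hom: "(\<lambda>c. M +> \<phi> c) \<in> ring_hom k (R Quot M)"
    using ring_hom_trans[OF \<phi> h.homh] by (simp add: comp_def)
  interpret hk: ring_hom_ring k "R Quot M" "\<lambda>c. M +> \<phi> c"
    by (rule ring_hom_ringI2[OF k.ring_axioms A.ring_axioms hom])
  let ?K = "(\<lambda>c. M +> \<phi> c) ` carrier k"
  show K: "subfield ?K (R Quot M)"
    using hk.img_is_subfield[OF k.carrier_is_subfield A.one_not_zero] by blast
  have surj: "(+>) M ` carrier R = carrier (R Quot M)"
    by (rule carrier_FactRing[symmetric])
  note zero_iff = M.coset_eq_zero_iff
  have gen: "generate_ring (R Quot M) (?K \<union> (+>) M ` S) = carrier (R Quot M)"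
    using surjective_image_generate_ring[OF h.homh ring_axioms A.ring_axioms surj _ S(3)]
      S(2) ring_hom_closed[OF \<phi>] by (auto simp: image_Un image_image image_subset_iff)
  have "A.G_subring (carrier (R Quot M))"
    unfolding A.G_subring_def
  proof (rule bexI[of _ "M +> f"], rule ballI)
    show "M +> f \<in> carrier (R Quot M) - {\<zero>\<^bsub>R Quot M\<^esub>}" using f(1) zero_iff by auto
    fix b assume b: "b \<in> carrier (R Quot M) - {\<zero>\<^bsub>R Quot M\<^esub>}"
    then obtain a where a: "a \<in> carrier R" "b = M +> a" using surj by auto
    then have "a \<in> carrier R - M" using b zero_iff by auto
    then obtain g and n :: nat where g: "g \<in> carrier R" "f [^] n \<ominus> a \<otimes> g \<in> M" using f(2) by blast
    have "M +> (f [^] n \<ominus> a \<otimes> g) = \<zero>\<^bsub>R Quot M\<^esub>" using zero_iff g a f(1) by simp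
    then have "b \<otimes>\<^bsub>R Quot M\<^esub> (M +> g) = (M +> f) [^]\<^bsub>R Quot M\<^esub> n"
      using a g(1) f(1) by (simp add: minus_eq h.hom_nat_pow A.minus_eq[symmetric])
    then show "\<exists>g \<in> carrier (R Quot M). \<exists>n::nat. b \<otimes>\<^bsub>R Quot M\<^esub> g = (M +> f) [^]\<^bsub>R Quot M\<^esub> n"
      using g(1) h.hom_closed by blast
  qed
  then show "(A.algebraic over ?K) x" if "x \<in> carrier (R Quot M)"
    using A.finitely_generated_algebraic[OF K _ _ gen _ that] S(1,2) h.hom_closed by blast
qed

section \<open>Ideals avoiding the powers of an element\<close>

context cring
begin

lemma exists_ideal_avoiding_powers:
  assumes P: "ideal P R" and f: "\<And>n::nat. f [^] n \<notin> P"
  obtains M where "ideal M R" "P \<subseteq> M" "\<And>n::nat. f [^] n \<notin> M"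
    "\<forall>I. ideal I R \<longrightarrow> M \<subseteq> I \<longrightarrow> (\<forall>n::nat. f [^] n \<notin> I) \<longrightarrow> I = M"
proof -
  let ?A = "{I. ideal I R \<and> P \<subseteq> I \<and> (\<forall>n::nat. f [^] n \<notin> I)}"
  have "\<exists>M \<in> ?A. \<forall>I \<in> ?A. M \<subseteq> I \<longrightarrow> I = M"
  proof (rule subset_Zorn_nonempty)
    show "?A \<noteq> {}" using P f by blast
    fix C assume C: "C \<noteq> {}" "subset.chain ?A C"
    then have "subset.chain {I. ideal I R} C"
      unfolding pred_on.chain_def by blast
    then have "ideal (\<Union>C) R" using chain_Union_is_ideal[of C] C(1) by simp
    moreover have "P \<subseteq> \<Union>C" "\<forall>n::nat. f [^] n \<notin> \<Union>C"
      using C unfolding pred_on.chain_def by blast+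
    ultimately show "\<Union>C \<in> ?A" by blast
  qed
  then obtain M where M: "M \<in> ?A" "\<forall>I \<in> ?A. M \<subseteq> I \<longrightarrow> I = M" by (rule bexE)
  show thesis
  proof (rule that)
    show "ideal M R" "P \<subseteq> M" "\<And>n::nat. f [^] n \<notin> M" using M(1) by auto
    show "\<forall>I. ideal I R \<longrightarrow> M \<subseteq> I \<longrightarrow> (\<forall>n::nat. f [^] n \<notin> I) \<longrightarrow> I = M"
    proof (intro allI impI)
      fix I assume I: "ideal I R" "M \<subseteq> I" "\<forall>n::nat. f [^] n \<notin> I"
      then have "I \<in> ?A" using M(1) by blast
      with I(2) show "I = M" using M(2) by blast
    qed
  qed
qed

lemma ideal_add_cgenideal_memE:
  assumes "x \<in> M <+> PIdl a"
  obtains m g where "m \<in> M" "g \<in> carrier R" "x = m \<oplus> g \<otimes> a"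
  using assms unfolding set_add_def' cgenideal_def by blast

text \<open>An ideal maximal among those missing all powers of \<open>f\<close>; for \<open>f = 1\<close> it is a maximal ideal.\<close>

context
  fixes M f
  assumes M: "ideal M R" and f: "f \<in> carrier R" "\<And>n::nat. f [^] n \<notin> M"
    and max: "\<forall>I. ideal I R \<longrightarrow> M \<subseteq> I \<longrightarrow> (\<forall>n::nat. f [^] n \<notin> I) \<longrightarrow> I = M"
begin

text \<open>The ideal generated by \<open>M\<close> and \<open>a\<close> is strictly larger than
  \<open>M\<close>, so by maximality it contains a power of \<open>f\<close>.\<close>

lemma divides_power_mod:
  assumes a: "a \<in> carrier R - M"
  shows "\<exists>g \<in> carrier R. \<exists>n::nat. f [^] n \<ominus> a \<otimes> g \<in> M"
proof -
  interpret M: ideal M R by (rule M)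
  have I: "ideal (M <+> PIdl a) R" "M \<subseteq> M <+> PIdl a" "a \<in> M <+> PIdl a"
  proof -
    interpret a: ideal "PIdl a" R using a by (intro cgenideal_ideal) simp
    show "ideal (M <+> PIdl a) R" by (rule add_ideals[OF M a.ideal_axioms])
    show "M \<subseteq> M <+> PIdl a"
    proof
      fix m assume m: "m \<in> M"
      then have "m = m \<oplus> \<zero>" by (simp add: M.Icarr)
      with m show "m \<in> M <+> PIdl a" unfolding set_add_def' using a.zero_closed by blast
    qed
    have "a = \<zero> \<oplus> a" "a \<in> PIdl a" using a by (simp_all add: cgenideal_self)
    then show "a \<in> M <+> PIdl a" unfolding set_add_def' using M.zero_closed by blast
  qed
  have "M <+> PIdl a \<noteq> M" using I(3) a by auto
  then have "\<not> (\<forall>n::nat. f [^] n \<notin> M <+> PIdl a)" using max I(1,2) by blast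
  then obtain n :: nat where "f [^] n \<in> M <+> PIdl a" by blast
  then obtain m g where mg: "m \<in> M" "g \<in> carrier R" "f [^] n = m \<oplus> g \<otimes> a"
    by (rule ideal_add_cgenideal_memE)
  have "m \<oplus> g \<otimes> a \<ominus> a \<otimes> g = m"
    using a mg(2) M.Icarr[OF mg(1)] by (simp add: minus_eq a_assoc m_comm[of g a] r_neg)
  then show ?thesis using mg by metis
qed

text \<open>If \<open>a\<close> and \<open>b\<close> are outside \<open>M\<close>, each divides a
  power of \<open>f\<close> modulo \<open>M\<close>. Then \<open>a \<otimes> b\<close> divides the
  product of these powers, which is not in \<open>M\<close>.\<close>

lemma avoiding_powers_prime: "primeideal M R"
proof (rule primeidealI[OF M cring_axioms])
  interpret M: ideal M R by (rule M)
  show "carrier R \<noteq> M" using f by blast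
  fix a b assume ab: "a \<in> carrier R" "b \<in> carrier R" "a \<otimes> b \<in> M"
  show "a \<in> M \<or> b \<in> M"
  proof (rule ccontr)
    assume "\<not> (a \<in> M \<or> b \<in> M)"
    then obtain g h and n l :: nat where gh: "g \<in> carrier R" "f [^] n \<ominus> a \<otimes> g \<in> M"
      "h \<in> carrier R" "f [^] l \<ominus> b \<otimes> h \<in> M"
      using divides_power_mod ab by (metis DiffI)
    have ring: "p \<otimes> q = (p \<ominus> a \<otimes> g) \<otimes> q \<oplus> (a \<otimes> g) \<otimes> (q \<ominus> b \<otimes> h) \<oplus> (g \<otimes> h) \<otimes> (a \<otimes> b)"
      if "p \<in> carrier R" "q \<in> carrier R" for p q
      using that ab gh(1,3) by algebra
    have "f [^] (n + l) = (f [^] n \<ominus> a \<otimes> g) \<otimes> f [^] l \<oplus> (a \<otimes> g) \<otimes> (f [^] l \<ominus> b \<otimes> h)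
        \<oplus> (g \<otimes> h) \<otimes> (a \<otimes> b)"
      using ring[of "f [^] n" "f [^] l"] f(1) by (simp add: nat_pow_mult)
    then have "f [^] (n + l) \<in> M"
      using ab gh f(1) by (simp add: M.I_l_closed M.I_r_closed)
    then show False using f(2) by blast
  qed
qed

end

lemma maximalideal_of_quotient_field:
  assumes M: "ideal M R" and field: "field (R Quot M)"
  shows "maximalideal M R"
proof (rule maximalidealI[OF M])
  interpret M: ideal M R by (rule M)
  interpret A: field "R Quot M" by (rule field)
  interpret h: ring_hom_ring R "R Quot M" "(+>) M" by (rule M.rcos_ring_hom_ring)
  have "\<one> \<notin> M" using M.coset_eq_zero_iff[of \<one>] h.hom_one A.one_not_zero by simp
  then show "carrier R \<noteq> M" by blast
  fix J assume J: "ideal J R" "M \<subseteq> J" "J \<subseteq> carrier R"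
  interpret J: ideal J R by (rule J(1))
  show "J = M \<or> J = carrier R"
  proof (cases "J = M")
    case False
    then obtain a where a: "a \<in> J" "a \<notin> M" using J by blast
    then have "M +> a \<in> carrier (R Quot M)" "M +> a \<noteq> \<zero>\<^bsub>R Quot M\<^esub>"
      using M.coset_eq_zero_iff[of a] J.Icarr by auto
    then have "M +> a \<in> Units (R Quot M)" using A.field_Units by blast
    then obtain y where "y \<in> carrier (R Quot M)" "(M +> a) \<otimes>\<^bsub>R Quot M\<^esub> y = \<one>\<^bsub>R Quot M\<^esub>"
      unfolding Units_def by blast
    then obtain b where b: "b \<in> carrier R" "(M +> a) \<otimes>\<^bsub>R Quot M\<^esub> (M +> b) = \<one>\<^bsub>R Quot M\<^esub>"
      unfolding carrier_FactRing by blast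
    have aR: "a \<in> carrier R" using a(1) J.Icarr by blast
    have "M +> (\<one> \<ominus> a \<otimes> b) = \<zero>\<^bsub>R Quot M\<^esub>"
      using aR b by (simp add: minus_eq A.r_neg)
    then have "\<one> \<ominus> a \<otimes> b \<in> J"
      using M.coset_eq_zero_iff[of "\<one> \<ominus> a \<otimes> b"] aR b(1) J(2) by auto
    then have "(\<one> \<ominus> a \<otimes> b) \<oplus> a \<otimes> b \<in> J" using a(1) b(1) by (intro J.a_closed J.I_r_closed)
    moreover have "(\<one> \<ominus> a \<otimes> b) \<oplus> a \<otimes> b = \<one>" using aR b(1) by algebra
    ultimately show ?thesis using J.one_imp_carrier by simp
  qed simp
qed

end

section \<open>Cores of prime ideals\<close>

lemma (in primeideal) pow_mem_imp_mem:
  assumes "x \<in> carrier R" "x [^] (n::nat) \<in> I"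
  shows "x \<in> I"
  using assms(2)
proof (induction n)
  case 0
  then show ?case using I_notcarr one_imp_carrier by simp
next
  case (Suc n)
  then show ?case using I_prime[of "x [^] n" x] assms(1) by auto
qed

definition (in ring) radical :: "'a set \<Rightarrow> 'a set" where
  "radical I = {x \<in> carrier R. \<exists>n::nat. x [^] n \<in> I}"

context cring
begin

lemma add_pow_mem_ideal:
  assumes "ideal I R" "x \<in> carrier R" "y \<in> carrier R" "x [^] (n::nat) \<in> I" "y [^] (m::nat) \<in> I"
  shows "(x \<oplus> y) [^] (n + m) \<in> I"
proof -
  interpret I: ideal I R by fact
  \<comment> \<open>Replaces the binomial expansion: one factor \<open>x \<oplus> y\<close> is
    multiplied out at a time, and \<open>c\<close> bounds what the exponents still lack. Truncated
    subtraction covers \<open>a\<close> beyond \<open>n\<close> and \<open>b\<close> beyond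
    \<open>m\<close>.\<close>
  have "x [^] a \<otimes> y [^] b \<otimes> (x \<oplus> y) [^] c \<in> I" if "n - a + (m - b) \<le> c" for a b c :: nat
    using that
  proof (induction c arbitrary: a b)
    case (0 a b)
    then have "x [^] a = x [^] n \<otimes> x [^] (a - n)" using assms by (simp add: nat_pow_mult)
    then show ?case using assms I.I_r_closed by simp
  next
    case (Suc c a b)
    have in_I: "x [^] a \<otimes> y [^] b \<otimes> z \<in> I" if ab: "n \<le> a \<or> m \<le> b" and z: "z \<in> carrier R" for z
      using ab
    proof
      assume "n \<le> a"
      then have "x [^] a = x [^] n \<otimes> x [^] (a - n)" using assms by (simp add: nat_pow_mult)
      then show ?thesis using assms z I.I_r_closed by simp
    next
      assume "m \<le> b"
      then have "y [^] b = y [^] m \<otimes> y [^] (b - m)" using assms by (simp add: nat_pow_mult)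
      then show ?thesis using assms z I.I_r_closed I.I_l_closed by simp
    qed
    show ?case
    proof (cases "n \<le> a \<or> m \<le> b")
      case True
      then show ?thesis using assms(2,3) by (intro in_I) simp_all
    next
      case False
      have ring: "p \<otimes> q \<otimes> (z \<otimes> (x \<oplus> y)) = (p \<otimes> x) \<otimes> q \<otimes> z \<oplus> p \<otimes> (q \<otimes> y) \<otimes> z"
        if "p \<in> carrier R" "q \<in> carrier R" "z \<in> carrier R" for p q z
        using that assms(2,3) by algebra
      have "x [^] a \<otimes> y [^] b \<otimes> (x \<oplus> y) [^] Suc c =
          x [^] Suc a \<otimes> y [^] b \<otimes> (x \<oplus> y) [^] c \<oplus> x [^] a \<otimes> y [^] Suc b \<otimes> (x \<oplus> y) [^] c"
        using ring[of "x [^] a" "y [^] b" "(x \<oplus> y) [^] c"] assms(2,3) by simp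
      moreover have "x [^] Suc a \<otimes> y [^] b \<otimes> (x \<oplus> y) [^] c \<in> I"
        "x [^] a \<otimes> y [^] Suc b \<otimes> (x \<oplus> y) [^] c \<in> I"
        using False Suc.prems by (intro Suc.IH; linarith)+
      ultimately show ?thesis by (simp only: I.a_closed)
    qed
  qed
  from this[of 0 0 "n + m"] show ?thesis using assms by simp
qed

lemma radical_ideal:
  assumes "ideal I R"
  shows "ideal (radical I) R"
proof -
  interpret I: ideal I R by fact
  show ?thesis
  proof (rule idealI[OF ring_axioms])
    show mult: "x \<otimes> a \<in> radical I" if a: "a \<in> radical I" and x: "x \<in> carrier R" for a x
    proof -
      obtain n :: nat where "a \<in> carrier R" "a [^] n \<in> I" using a by (auto simp: radical_def)
      then show ?thesis
        using x I.I_l_closed[of "a [^] n" "x [^] n"] by (auto simp: radical_def nat_pow_distrib)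
    qed
    show "a \<otimes> x \<in> radical I" if "a \<in> radical I" "x \<in> carrier R" for a x
      using mult[OF that] that m_comm by (simp add: radical_def)
    show "subgroup (radical I) (add_monoid R)"
    proof (rule add.subgroupI)
      show "radical I \<subseteq> carrier R" by (auto simp: radical_def)
      have "\<zero> [^] (1::nat) \<in> I" by simp
      then show "radical I \<noteq> {}" unfolding radical_def by blast
      show "\<ominus> a \<in> radical I" if "a \<in> radical I" for a
        using mult[OF that, of "\<ominus> \<one>"] that by (simp add: l_minus radical_def)
      show "a \<oplus> b \<in> radical I" if "a \<in> radical I" "b \<in> radical I" for a b
        using that add_pow_mem_ideal[OF assms, of a b] unfolding radical_def by blast
    qed
  qed
qed

section \<open>Derivations acting on radicals and radical ideals\<close>

lemma derivation_power:
  fixes n :: nat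
  assumes d: "derivation R d" and x: "x \<in> carrier R"
  shows "d (x [^] Suc n) = [Suc n] \<cdot> \<one> \<otimes> (x [^] n \<otimes> d x)"
proof (induction n)
  case 0
  have "d x \<in> carrier R" using d x by (auto simp: derivation_def)
  then show ?case using x by simp
next
  case (Suc n)
  have ring: "(\<nu> \<otimes> (q \<otimes> z)) \<otimes> x \<oplus> q \<otimes> x \<otimes> z = (\<nu> \<oplus> \<one>) \<otimes> (q \<otimes> x \<otimes> z)"
    if "q \<in> carrier R" "z \<in> carrier R" "\<nu> \<in> carrier R" for q z \<nu>
    using that x by algebra
  have "d (x [^] Suc (Suc n)) = d (x [^] Suc n) \<otimes> x \<oplus> x [^] Suc n \<otimes> d x"
    using d x nat_pow_Suc[of x "Suc n"] unfolding derivation_def by (metis nat_pow_closed)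
  also have "\<dots> = ([Suc n] \<cdot> \<one> \<oplus> \<one>) \<otimes> (x [^] n \<otimes> x \<otimes> d x)"
    unfolding Suc.IH[unfolded nat_pow_Suc] nat_pow_Suc
    using d x by (intro ring) (auto simp: derivation_def)
  also have "[Suc n] \<cdot> \<one> \<oplus> \<one> = [Suc (Suc n)] \<cdot> \<one>" by simp
  finally show ?case by simp
qed

text \<open>If \<open>x\<^sup>n\<close> lies in \<open>I\<close>, differentiating turns one factor \<open>x\<close> at a time into two factors \<open>d x\<close>,
  which ends with a power of \<open>d x\<close>.\<close>

lemma derivation_radical:
  assumes I: "ideal I R" and d: "derivation R d" and d_I: "\<And>i. i \<in> I \<Longrightarrow> d i \<in> I"
    and units: "\<And>n::nat. n > 0 \<Longrightarrow> [n] \<cdot> \<one> \<in> Units R"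
    and x: "x \<in> radical I"
  shows "d x \<in> radical I"
proof -
  interpret I: ideal I R by fact
  obtain n :: nat where xn: "x \<in> carrier R" "x [^] n \<in> I" using x by (auto simp: radical_def)
  have car: "d y \<in> carrier R" if "y \<in> carrier R" for y
    using d that by (auto simp: derivation_def)
  define z where "z = d x"
  have z: "z \<in> carrier R" using car xn z_def by simp
  have step: "x [^] m \<otimes> z [^] Suc (Suc j) \<in> I" if y: "x [^] Suc m \<otimes> z [^] j \<in> I" for m j :: nat
  proof -
    define y where "y = x [^] Suc m \<otimes> z [^] j"
    define \<nu> where "\<nu> = [Suc m] \<cdot> \<one>"
    have \<nu>: "\<nu> \<in> Units R" unfolding \<nu>_def by (rule units) simp
    then have \<nu>_closed: "\<nu> \<in> carrier R" by (rule Units_closed)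
    \<comment> \<open>The unwanted part of \<open>d y\<close> contains \<open>d (z [^] j)\<close>.
      One more factor \<open>z\<close> makes it a multiple of \<open>z [^] j\<close>, hence of
      \<open>y\<close>, and so an element of \<open>I\<close>; this is why each step spends two
      factors \<open>z\<close>.\<close>
    obtain e where e: "e \<in> carrier R" "z \<otimes> d (z [^] j) = z [^] j \<otimes> e"
    proof (cases j)
      case 0
      have one: "d \<one> \<in> carrier R" using car by simp
      have "d (\<one> \<otimes> \<one>) = d \<one> \<otimes> \<one> \<oplus> \<one> \<otimes> d \<one>"
        using d unfolding derivation_def by blast
      then have "d \<one> = \<zero>" using one by simp
      then show ?thesis using that[of \<zero>] 0 z by simp
    next
      case (Suc i)
      have "z \<otimes> d (z [^] Suc i) = z [^] Suc i \<otimes> ([Suc i] \<cdot> \<one> \<otimes> d z)"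
        unfolding derivation_power[OF d z] using z car by (simp add: m_ac del: add.nat_pow_Suc)
      then show ?thesis using that[of "[Suc i] \<cdot> \<one> \<otimes> d z"] Suc z car by simp
    qed
    have ring: "z \<otimes> (\<nu> \<otimes> (p \<otimes> z) \<otimes> q \<oplus> x' \<otimes> w) \<ominus> x' \<otimes> q \<otimes> e = \<nu> \<otimes> (p \<otimes> (q \<otimes> z \<otimes> z))"
      if "z \<otimes> w = q \<otimes> e" "p \<in> carrier R" "q \<in> carrier R" "x' \<in> carrier R" "w \<in> carrier R"
      for p q x' w
    proof -
      have "z \<otimes> (\<nu> \<otimes> (p \<otimes> z) \<otimes> q \<oplus> x' \<otimes> w) \<ominus> x' \<otimes> q \<otimes> e
          = \<nu> \<otimes> (p \<otimes> (q \<otimes> z \<otimes> z)) \<oplus> (x' \<otimes> (z \<otimes> w) \<ominus> x' \<otimes> (q \<otimes> e))"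
        using that(2-) \<nu>_closed e(1) z by algebra
      then show ?thesis using that \<nu>_closed e(1) z by (simp add: minus_eq r_neg)
    qed
    have "d y = \<nu> \<otimes> (x [^] m \<otimes> z) \<otimes> z [^] j \<oplus> x [^] Suc m \<otimes> d (z [^] j)"
      unfolding y_def \<nu>_def z_def derivation_power[OF d xn(1), symmetric]
      using d xn(1) z unfolding derivation_def z_def by (metis nat_pow_closed)
    then have "z \<otimes> d y \<ominus> y \<otimes> e = \<nu> \<otimes> (x [^] m \<otimes> (z [^] j \<otimes> z \<otimes> z))"
      unfolding y_def using e xn(1) z car by (simp only: ring nat_pow_closed)
    moreover have "z \<otimes> d y \<ominus> y \<otimes> e \<in> I"
      using y d_I[of y] e z unfolding y_def[symmetric]
      by (simp add: minus_eq I.I_l_closed I.I_r_closed)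
    ultimately have "\<nu> \<otimes> (x [^] m \<otimes> z [^] Suc (Suc j)) \<in> I" by simp
    \<comment> \<open>The integer produced by the power rule is divided out; characteristic zero
      enters here.\<close>
    then have "inv \<nu> \<otimes> (\<nu> \<otimes> (x [^] m \<otimes> z [^] Suc (Suc j))) \<in> I"
      by (rule I.I_l_closed) (rule Units_inv_closed[OF \<nu>])
    then show ?thesis using \<nu> \<nu>_closed Units_l_inv[OF \<nu>] xn(1) z by (simp add: m_assoc[symmetric])
  qed
  have "x [^] (n - k) \<otimes> z [^] (2 * k) \<in> I" if "k \<le> n" for k
    using that
  proof (induction k)
    case 0
    then show ?case using xn by simp
  next
    case (Suc k)
    then have "n - k = Suc (n - Suc k)" by simp
    moreover have "x [^] (n - k) \<otimes> z [^] (2 * k) \<in> I" using Suc by simp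
    ultimately have "x [^] Suc (n - Suc k) \<otimes> z [^] (2 * k) \<in> I" by (simp only:)
    then show ?case using step[of "n - Suc k" "2 * k"] by simp
  qed
  from this[of n] show ?thesis using z by (auto simp: radical_def z_def)
qed

text \<open>Multiplying \<open>d (a \<otimes> b) = d a \<otimes> b \<oplus> a \<otimes> d b\<close>
  by \<open>a \<otimes> d b\<close> makes the first summand a multiple of
  \<open>a \<otimes> b\<close>, so the square of \<open>a \<otimes> d b\<close> lies in
  \<open>I\<close>.\<close>

lemma derivation_mult_mem_radical_ideal:
  assumes I: "ideal I R" and rad: "radical I \<subseteq> I" and d: "derivation R d"
    and d_I: "\<And>i. i \<in> I \<Longrightarrow> d i \<in> I"
    and a: "a \<in> carrier R" and b: "b \<in> carrier R" and ab: "a \<otimes> b \<in> I"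
  shows "a \<otimes> d b \<in> I"
proof -
  interpret I: ideal I R by fact
  have car: "d a \<in> carrier R" "d b \<in> carrier R"
    using d a b by (auto simp: derivation_def)
  have "d (a \<otimes> b) = d a \<otimes> b \<oplus> a \<otimes> d b"
    using d a b unfolding derivation_def by blast
  moreover have "(d a \<otimes> b \<oplus> a \<otimes> d b) \<otimes> (a \<otimes> d b) \<ominus> (d a \<otimes> d b) \<otimes> (a \<otimes> b)
      = (a \<otimes> d b) \<otimes> (a \<otimes> d b)"
    using a b car by algebra
  moreover have "d (a \<otimes> b) \<otimes> (a \<otimes> d b) \<ominus> (d a \<otimes> d b) \<otimes> (a \<otimes> b) \<in> I"
    using d_I[OF ab] ab a car by (simp add: minus_eq I.I_l_closed I.I_r_closed)
  ultimately have "(a \<otimes> d b) [^] (2::nat) \<in> I"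
    using a car by (simp add: numeral_2_eq_2)
  then show ?thesis using rad a car unfolding radical_def by blast
qed

lemma ideal_colon:
  assumes "ideal I R" "a \<in> carrier R"
  shows "ideal {b \<in> carrier R. a \<otimes> b \<in> I} R"
proof -
  interpret I: ideal I R by fact
  show ?thesis
  proof (rule idealI[OF ring_axioms])
    show "subgroup {b \<in> carrier R. a \<otimes> b \<in> I} (add_monoid R)"
      using assms(2) by (intro add.subgroupI) (auto simp: r_distr r_minus)
    show l: "x \<otimes> b \<in> {b \<in> carrier R. a \<otimes> b \<in> I}"
      if "b \<in> {b \<in> carrier R. a \<otimes> b \<in> I}" "x \<in> carrier R" for b x
      using that assms(2) I.I_l_closed[of "a \<otimes> b" x] by (simp add: m_lcomm)
    show "b \<otimes> x \<in> {b \<in> carrier R. a \<otimes> b \<in> I}"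
      if "b \<in> {b \<in> carrier R. a \<otimes> b \<in> I}" "x \<in> carrier R" for b x
      using l[OF that] that by (simp add: m_comm)
  qed
qed

end

section \<open>Bidifferential radicals, colon ideals and cores\<close>

context bidifferential_ring
begin

text \<open>Collects the left and right brackets in one set of derivations, so that results about a
  single derivation settle both sides at once.\<close>

lemma bidifferential_ideal_iff:
  "bidifferential_ideal R bd I \<longleftrightarrow> ideal I R \<and>
     (\<forall>r \<in> carrier R. \<forall>d \<in> {\<lambda>s. bd r s, \<lambda>s. bd s r}. \<forall>i \<in> I. d i \<in> I)"
  by (auto simp: bidifferential_ideal_def)

lemma bidifferential_idealD:
  assumes "bidifferential_ideal R bd I" "r \<in> carrier R" "d \<in> {\<lambda>s. bd r s, \<lambda>s. bd s r}" "i \<in> I"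
  shows "d i \<in> I"
  using assms by (auto simp: bidifferential_ideal_def)

lemma derivation_bd:
  "r \<in> carrier R \<Longrightarrow> d \<in> {\<lambda>s. bd r s, \<lambda>s. bd s r} \<Longrightarrow> derivation R d"
  using biderivation by (auto simp: biderivation_def)

lemma bidifferential_radical:
  assumes "bidifferential_ideal R bd I" and "\<And>n::nat. n > 0 \<Longrightarrow> [n] \<cdot> \<one> \<in> Units R"
  shows "bidifferential_ideal R bd (radical I)"
  unfolding bidifferential_ideal_iff
proof (intro conjI ballI)
  have I: "ideal I R" using assms(1) by (simp add: bidifferential_ideal_def)
  then show "ideal (radical I) R" by (rule radical_ideal)
  fix r d x assume r: "r \<in> carrier R" "d \<in> {\<lambda>s. bd r s, \<lambda>s. bd s r}" and x: "x \<in> radical I"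
  show "d x \<in> radical I"
  proof (rule derivation_radical[OF I derivation_bd[OF r] _ assms(2) x])
    show "d i \<in> I" if "i \<in> I" for i
      by (rule bidifferential_idealD[OF assms(1) r that])
  qed
qed

lemma bidifferential_colon:
  assumes I: "bidifferential_ideal R bd I" and "radical I \<subseteq> I" "a \<in> carrier R"
  shows "bidifferential_ideal R bd {b \<in> carrier R. a \<otimes> b \<in> I}"
  unfolding bidifferential_ideal_iff
proof (intro conjI ballI)
  have I': "ideal I R" using I by (simp add: bidifferential_ideal_def)
  then show "ideal {b \<in> carrier R. a \<otimes> b \<in> I} R" using assms(3) by (rule ideal_colon)
  fix r d b assume r: "r \<in> carrier R" "d \<in> {\<lambda>s. bd r s, \<lambda>s. bd s r}"
    and b: "b \<in> {b \<in> carrier R. a \<otimes> b \<in> I}"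
  note d = derivation_bd[OF r]
  have "a \<otimes> d b \<in> I"
  proof (rule derivation_mult_mem_radical_ideal[OF I' assms(2) d _ assms(3)])
    show "d i \<in> I" if "i \<in> I" for i
      by (rule bidifferential_idealD[OF I r that])
  qed (use b in auto)
  moreover have "d b \<in> carrier R" using b d by (auto simp: derivation_def)
  ultimately show "d b \<in> {b \<in> carrier R. a \<otimes> b \<in> I}" by simp
qed

text \<open>The radical of the core \<open>J\<close> is bidifferential and lies in \<open>M\<close>,
  so \<open>J\<close> is radical and its colon ideals are bidifferential. A colon ideal not
  contained in \<open>J\<close> therefore meets the complement of \<open>M\<close>. If
  \<open>a \<otimes> b \<in> J\<close> with both factors outside \<open>J\<close>, applying this to
  \<open>a\<close> gives \<open>c\<close>, and applying it to \<open>c\<close> gives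
  \<open>e\<close>, both outside \<open>M\<close>, with
  \<open>c \<otimes> e \<in> J \<subseteq> M\<close>.\<close>

lemma bidifferential_core_prime:
  assumes M: "primeideal M R" and units: "\<And>n::nat. n > 0 \<Longrightarrow> [n] \<cdot> \<one> \<in> Units R"
  shows "primeideal (bidifferential_core R bd M) R"
proof -
  interpret M: primeideal M R by fact
  define J where "J = bidifferential_core R bd M"
  note greatest = bidifferential_core_greatest[OF M.ideal_axioms, folded J_def]
  interpret J: ideal J R using greatest(1) by (simp add: bidifferential_ideal_def)
  have "radical J \<subseteq> M"
    using greatest(2) M.pow_mem_imp_mem unfolding radical_def by blast
  then have rad: "radical J \<subseteq> J"
    using greatest(3) bidifferential_radical[OF greatest(1) units] by blast
  have colon: "\<exists>c \<in> carrier R - M. a \<otimes> c \<in> J"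
    if "a \<in> carrier R" "b \<in> carrier R" "a \<otimes> b \<in> J" "b \<notin> J" for a b
    using greatest(3)[OF bidifferential_colon[OF greatest(1) rad that(1)]] that by blast
  show ?thesis
    unfolding J_def[symmetric]
  proof (rule primeidealI[OF J.ideal_axioms cring_axioms])
    show "carrier R \<noteq> J" using greatest(2) M.I_notcarr M.a_subset by blast
    fix a b assume ab: "a \<in> carrier R" "b \<in> carrier R" "a \<otimes> b \<in> J"
    show "a \<in> J \<or> b \<in> J"
    proof (rule ccontr)
      assume neg: "\<not> (a \<in> J \<or> b \<in> J)"
      obtain c where c: "c \<in> carrier R - M" "a \<otimes> c \<in> J"
        using colon[OF ab] neg by blast
      obtain e where e: "e \<in> carrier R - M" "c \<otimes> e \<in> J"
        using colon[of c a] c ab neg by (auto simp: m_comm)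
      have "c \<otimes> e \<in> M" using e(2) greatest(2) by blast
      then show False using M.I_prime[of c e] c e by blast
    qed
  qed
qed

end

section \<open>Constants of the fraction field\<close>

text \<open>\<open>homogenize p s r\<close> stands for \<open>r\<^sup>n p(s / r)\<close>, where \<open>n\<close> is the length of \<open>p\<close>.\<close>

fun (in ring) homogenize :: "'a list \<Rightarrow> 'a \<Rightarrow> 'a \<Rightarrow> 'a" where
  "homogenize [] s r = \<zero>"
| "homogenize (c # p) s r = r \<otimes> (c \<otimes> s [^] length p \<oplus> homogenize p s r)"

lemma (in ring) homogenize_closed [simp]:
  "set p \<subseteq> carrier R \<Longrightarrow> s \<in> carrier R \<Longrightarrow> r \<in> carrier R \<Longrightarrow> homogenize p s r \<in> carrier R"
  by (induction p) auto

text \<open>Needed for two homomorphisms, the projection to \<open>R Quot M\<close> and the map to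
  the fraction field; \<open>y\<close> is the value of \<open>s / r\<close> in either. The exponent
  \<open>length p\<close>, one more than the degree, keeps the recursion uniform down to the empty
  list.\<close>

lemma (in ring) hom_homogenize:
  assumes h: "h \<in> ring_hom R S" and S: "cring S" and p: "set p \<subseteq> carrier R"
    and r: "r \<in> carrier R" and s: "s \<in> carrier R" and y: "y \<in> carrier S"
    and eq: "h r \<otimes>\<^bsub>S\<^esub> y = h s"
  shows "h (homogenize p s r) = h r [^]\<^bsub>S\<^esub> length p \<otimes>\<^bsub>S\<^esub> ring.eval S (map h p) y"
proof -
  interpret S: cring S by fact
  interpret ring_hom_ring R S h by (rule ring_hom_ringI2[OF ring_axioms S.ring_axioms h])
  show ?thesis
    using p
  proof (induction p)
    case Nil
    then show ?case by simp
  next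
    case (Cons c p)
    let ?e = "S.eval (map h p) y"
    have e: "?e \<in> carrier S" using Cons.prems y by (intro S.eval_in_carrier) auto
    have c: "h c \<in> carrier S" "h r \<in> carrier S" using Cons.prems r by auto
    have ring: "x \<otimes>\<^bsub>S\<^esub> (c \<otimes>\<^bsub>S\<^esub> (q \<otimes>\<^bsub>S\<^esub> w) \<oplus>\<^bsub>S\<^esub> q \<otimes>\<^bsub>S\<^esub> e) = q \<otimes>\<^bsub>S\<^esub> x \<otimes>\<^bsub>S\<^esub> (c \<otimes>\<^bsub>S\<^esub> w \<oplus>\<^bsub>S\<^esub> e)"
      if "x \<in> carrier S" "c \<in> carrier S" "q \<in> carrier S" "w \<in> carrier S" "e \<in> carrier S" for x c q w e
      using that by algebra
    have "h (homogenize (c # p) s r) = h r \<otimes>\<^bsub>S\<^esub> (h c \<otimes>\<^bsub>S\<^esub> (h r [^]\<^bsub>S\<^esub> length p \<otimes>\<^bsub>S\<^esub> y [^]\<^bsub>S\<^esub> length p)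
        \<oplus>\<^bsub>S\<^esub> h r [^]\<^bsub>S\<^esub> length p \<otimes>\<^bsub>S\<^esub> ?e)"
      using Cons r s by (simp add: hom_nat_pow eq[symmetric] S.nat_pow_distrib c(2) y)
    also have "\<dots> = h r [^]\<^bsub>S\<^esub> length p \<otimes>\<^bsub>S\<^esub> h r \<otimes>\<^bsub>S\<^esub> (h c \<otimes>\<^bsub>S\<^esub> y [^]\<^bsub>S\<^esub> length p \<oplus>\<^bsub>S\<^esub> ?e)"
      using c e y by (intro ring) simp_all
    finally show ?case by simp
  qed
qed

section \<open>Arithmetic of constants\<close>

context bidifferential_ring
begin

lemma bd_zero [simp]:
  assumes "r \<in> carrier R"
  shows "bd r \<zero> = \<zero>" "bd \<zero> r = \<zero>"
  using bidifferential_ideal_zero assms by (auto simp: bidifferential_ideal_def)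

lemma bd_one [simp]:
  assumes "r \<in> carrier R"
  shows "bd r \<one> = \<zero>" "bd \<one> r = \<zero>"
  using bd_mult_right[of r \<one> \<one>] bd_mult_left[of r \<one> \<one>] assms by simp_all

lemma constantsI:
  assumes "c \<in> carrier R" "\<And>s. s \<in> carrier R \<Longrightarrow> bd c s = \<zero>" "\<And>s. s \<in> carrier R \<Longrightarrow> bd s c = \<zero>"
  shows "c \<in> constants R bd"
  using assms by (simp add: constants_def)

lemma constantsD:
  assumes "c \<in> constants R bd"
  shows "c \<in> carrier R" "s \<in> carrier R \<Longrightarrow> bd c s = \<zero>" "s \<in> carrier R \<Longrightarrow> bd s c = \<zero>"
  using assms by (auto simp: constants_def)

lemma subring_constants: "subring (constants R bd) R"
proof (rule subringI)
  show "constants R bd \<subseteq> carrier R" by (auto simp: constants_def)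
  show "\<one> \<in> constants R bd" by (simp add: constantsI)
  show "\<ominus> c \<in> constants R bd" if c: "c \<in> constants R bd" for c
  proof (rule constantsI)
    fix s assume s: "s \<in> carrier R"
    show "bd (\<ominus> c) s = \<zero>"
      using bd_add_left[of s c "\<ominus> c"] constantsD[OF c] s by (simp add: r_neg)
    show "bd s (\<ominus> c) = \<zero>"
      using bd_add_right[of s c "\<ominus> c"] constantsD[OF c] s by (simp add: r_neg)
  qed (use constantsD[OF c] in simp)
  show "c \<otimes> e \<in> constants R bd" "c \<oplus> e \<in> constants R bd"
    if c: "c \<in> constants R bd" and e: "e \<in> constants R bd" for c e
    using constantsD[OF c] constantsD[OF e]
    by (auto intro!: constantsI simp: bd_add_left bd_add_right bd_mult_left bd_mult_right)
qed

lemma eval_constants: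
  assumes "set p \<subseteq> constants R bd" "x \<in> constants R bd"
  shows "eval p x \<in> constants R bd"
  using ring.eval_in_carrier[OF subring_is_ring[OF subring_constants], of p x] assms
    eval_consistent[OF subring_constants] by simp

end

text \<open>Bracketing \<open>c \<otimes> inv c = \<one>\<close> with \<open>s\<close> leaves
  \<open>c \<otimes> bd (inv c) s = \<zero>\<close>, and likewise on the other side.\<close>

lemma (in bidifferential_field) constants_inv:
  assumes c: "c \<in> constants R bd" "c \<noteq> \<zero>"
  shows "inv c \<in> constants R bd"
proof (rule constantsI)
  note D = constantsD[OF c(1)]
  have unit: "c \<in> Units R" using D(1) c(2) field_Units by simp
  then show inv: "inv c \<in> carrier R" by simp
  fix s assume s: "s \<in> carrier R"
  have "c \<otimes> bd (inv c) s = bd (c \<otimes> inv c) s" "c \<otimes> bd s (inv c) = bd s (c \<otimes> inv c)"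
    using bd_mult_left[of s c "inv c"] bd_mult_right[of s c "inv c"] D s inv by simp_all
  then show "bd (inv c) s = \<zero>" "bd s (inv c) = \<zero>"
    using unit s inv D(1) c(2) by (simp_all add: integral_iff)
qed

text \<open>Describes the map from \<open>R\<close> to Frac(R/P) without cosets and pairs.
  \<open>\<psi>\<close> may have a kernel, and being a fraction is expressed by multiplying out a
  denominator that \<open>\<psi>\<close> does not kill.\<close>

locale bidifferential_fractions =
  bidifferential_ring R bd + F: bidifferential_field F D
  for R :: "('a, 'n) ring_scheme" (structure) and bd and F :: "('b, 'm) ring_scheme" and D +
  fixes \<psi> :: "'a \<Rightarrow> 'b"
  assumes hom: "\<psi> \<in> ring_hom R F"
    and bd_hom: "r \<in> carrier R \<Longrightarrow> s \<in> carrier R \<Longrightarrow> D (\<psi> r) (\<psi> s) = \<psi> (bd r s)"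
    and fraction: "x \<in> carrier F \<Longrightarrow>
      \<exists>r \<in> carrier R. \<exists>s \<in> carrier R. \<psi> r \<noteq> \<zero>\<^bsub>F\<^esub> \<and> \<psi> r \<otimes>\<^bsub>F\<^esub> x = \<psi> s"
begin

lemma ring_hom_ring: "ring_hom_ring R F \<psi>"
  by (rule ring_hom_ringI2[OF ring_axioms F.ring_axioms hom])

text \<open>The denominators of a constant form a bidifferential ideal that is not contained in
  the kernel of \<open>\<psi>\<close>, so that one of them avoids \<open>M\<close>.\<close>

lemma constant_denominator:
  assumes M: "ideal M R"
    and ker: "\<And>r. r \<in> bidifferential_core R bd M \<Longrightarrow> \<psi> r = \<zero>\<^bsub>F\<^esub>"
    and x: "x \<in> constants F D"
  shows "\<exists>r \<in> carrier R - M. \<exists>s \<in> carrier R. \<psi> r \<otimes>\<^bsub>F\<^esub> x = \<psi> s"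
proof -
  interpret h: ring_hom_ring R F \<psi> by (rule ring_hom_ring)
  note X = F.constantsD[OF x]
  define I where "I = {r \<in> carrier R. \<exists>s \<in> carrier R. \<psi> r \<otimes>\<^bsub>F\<^esub> x = \<psi> s}"
  have I_iff: "r \<in> I \<longleftrightarrow> r \<in> carrier R \<and> (\<exists>s \<in> carrier R. \<psi> r \<otimes>\<^bsub>F\<^esub> x = \<psi> s)" for r
    unfolding I_def by (rule mem_Collect_eq)
  have I_mult: "t \<otimes> r \<in> I" if r: "r \<in> I" and t: "t \<in> carrier R" for r t
  proof -
    obtain s where s: "s \<in> carrier R" "\<psi> r \<otimes>\<^bsub>F\<^esub> x = \<psi> s" "r \<in> carrier R"
      using r unfolding I_iff by blast
    then have "\<psi> (t \<otimes> r) \<otimes>\<^bsub>F\<^esub> x = \<psi> (t \<otimes> s)"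
      using t X(1) by (simp add: F.m_assoc)
    then show ?thesis using s t unfolding I_iff by blast
  qed
  have "ideal I R"
  proof (rule idealI[OF ring_axioms])
    show "subgroup I (add_monoid R)"
    proof (rule add.subgroupI)
      show "I \<subseteq> carrier R" by (auto simp: I_iff)
      have "\<zero> \<in> I" using X(1) by (auto simp: I_iff intro!: bexI[of _ \<zero>])
      then show "I \<noteq> {}" by blast
      show "\<ominus> r \<in> I" if r: "r \<in> I" for r
      proof -
        have "r \<in> carrier R" using r by (simp add: I_iff)
        then have "\<ominus> r = \<ominus> \<one> \<otimes> r" by (simp add: l_minus)
        then show ?thesis using I_mult[OF r, of "\<ominus> \<one>"] by simp
      qed
      show "r \<oplus> t \<in> I" if rt: "r \<in> I" "t \<in> I" for r t
      proof -
        obtain s v where s: "s \<in> carrier R" "\<psi> r \<otimes>\<^bsub>F\<^esub> x = \<psi> s" "r \<in> carrier R"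
          "v \<in> carrier R" "\<psi> t \<otimes>\<^bsub>F\<^esub> x = \<psi> v" "t \<in> carrier R"
          using rt unfolding I_iff by blast
        then have "\<psi> (r \<oplus> t) \<otimes>\<^bsub>F\<^esub> x = \<psi> (s \<oplus> v)"
          using X(1) by (simp add: F.l_distr)
        then show ?thesis using s unfolding I_iff by blast
      qed
    qed
    show "t \<otimes> r \<in> I" if "r \<in> I" "t \<in> carrier R" for r t by (rule I_mult[OF that])
    show "r \<otimes> t \<in> I" if "r \<in> I" "t \<in> carrier R" for r t
      using I_mult[OF that] that by (simp add: I_iff m_comm)
  qed
  moreover have "bd t r \<in> I \<and> bd r t \<in> I" if r: "r \<in> I" and t: "t \<in> carrier R" for r t
  proof -
    obtain s where s: "s \<in> carrier R" "\<psi> r \<otimes>\<^bsub>F\<^esub> x = \<psi> s" "r \<in> carrier R"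
      using r unfolding I_iff by blast
    \<comment> \<open>As a constant, \<open>x\<close> passes through \<open>D\<close>; the numerator
      belonging to the bracket of \<open>r\<close> is the bracket of \<open>s\<close>.\<close>
    have "\<psi> (bd t r) \<otimes>\<^bsub>F\<^esub> x = D (\<psi> t) (\<psi> r \<otimes>\<^bsub>F\<^esub> x)" "\<psi> (bd r t) \<otimes>\<^bsub>F\<^esub> x = D (\<psi> r \<otimes>\<^bsub>F\<^esub> x) (\<psi> t)"
      using F.bd_mult_right[of "\<psi> t" "\<psi> r" x] F.bd_mult_left[of "\<psi> t" "\<psi> r" x] X s t
      by (simp_all add: bd_hom)
    then have "\<psi> (bd t r) \<otimes>\<^bsub>F\<^esub> x = \<psi> (bd t s)" "\<psi> (bd r t) \<otimes>\<^bsub>F\<^esub> x = \<psi> (bd s t)"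
      unfolding s(2) using bd_hom s t by simp_all
    then show ?thesis using s(1,3) t unfolding I_iff by blast
  qed
  ultimately have I: "bidifferential_ideal R bd I" by (simp add: bidifferential_ideal_def)
  obtain r where r: "r \<in> I" "\<psi> r \<noteq> \<zero>\<^bsub>F\<^esub>"
    using fraction[OF X(1)] unfolding I_iff by blast
  \<comment> \<open>Inside \<open>M\<close>, the ideal \<open>I\<close> would lie in the core and be
    killed by \<open>\<psi>\<close>, contrary to the choice of \<open>r\<close>.\<close>
  have "\<not> I \<subseteq> M"
    using bidifferential_core_greatest(3)[OF M I] ker r by blast
  then obtain q where "q \<in> I" "q \<notin> M" by blast
  then show ?thesis unfolding I_iff by blast
qed

text \<open>Were the constant \<open>e\<close> nonzero, a denominator outside \<open>M\<close> of the constant \<open>1 / e\<close>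
  would put \<open>r\<close> into \<open>M\<close>.\<close>

lemma constant_zero:
  assumes M: "primeideal M R"
    and ker: "\<And>r. r \<in> carrier R \<Longrightarrow> \<psi> r = \<zero>\<^bsub>F\<^esub> \<longleftrightarrow> r \<in> bidifferential_core R bd M"
    and e: "e \<in> constants F D"
    and r: "r \<in> carrier R - M" and s: "s \<in> M" and eq: "\<psi> r \<otimes>\<^bsub>F\<^esub> e = \<psi> s"
  shows "e = \<zero>\<^bsub>F\<^esub>"
proof (rule ccontr)
  interpret M: primeideal M R by fact
  interpret h: ring_hom_ring R F \<psi> by (rule ring_hom_ring)
  note core = bidifferential_core_greatest[OF M.ideal_axioms]
  assume nz: "e \<noteq> \<zero>\<^bsub>F\<^esub>"
  have eF: "e \<in> carrier F" using F.constantsD(1)[OF e] .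
  then have unit: "e \<in> Units F" using nz F.field_Units by simp
  have ker': "\<psi> r = \<zero>\<^bsub>F\<^esub>" if "r \<in> bidifferential_core R bd M" for r
    using that ker[of r] core(2) M.Icarr by blast
  obtain t w where t: "t \<in> carrier R - M" "w \<in> carrier R" "\<psi> t \<otimes>\<^bsub>F\<^esub> inv\<^bsub>F\<^esub> e = \<psi> w"
    using constant_denominator[OF M.ideal_axioms ker' F.constants_inv[OF e nz]] by blast
  have car: "r \<in> carrier R" "t \<in> carrier R" "s \<in> carrier R"
    using r t s M.Icarr by auto
  \<comment> \<open>The factors \<open>e\<close> and \<open>1/e\<close> cancel in the product of the
    two equations, so \<open>r \<otimes> t \<ominus> s \<otimes> w\<close> is in the kernel and
    hence in \<open>M\<close>. As \<open>s \<in> M\<close>, this forces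
    \<open>r \<otimes> t \<in> M\<close>.\<close>
  have "\<psi> (s \<otimes> w) = \<psi> s \<otimes>\<^bsub>F\<^esub> \<psi> w" using car t(2) by simp
  also have "\<dots> = (\<psi> r \<otimes>\<^bsub>F\<^esub> e) \<otimes>\<^bsub>F\<^esub> (\<psi> t \<otimes>\<^bsub>F\<^esub> inv\<^bsub>F\<^esub> e)" by (simp only: eq t(3))
  also have "\<dots> = (\<psi> r \<otimes>\<^bsub>F\<^esub> \<psi> t) \<otimes>\<^bsub>F\<^esub> (e \<otimes>\<^bsub>F\<^esub> inv\<^bsub>F\<^esub> e)"
    using car eF unit by (simp add: F.m_ac del: F.Units_r_inv F.Units_l_inv)
  also have "\<dots> = \<psi> (r \<otimes> t)" using car unit by simp
  finally have "\<psi> (r \<otimes> t \<ominus> s \<otimes> w) = \<zero>\<^bsub>F\<^esub>"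
    using car t(2) by (simp add: minus_eq F.r_neg)
  then have "r \<otimes> t \<ominus> s \<otimes> w \<in> M"
    using ker[of "r \<otimes> t \<ominus> s \<otimes> w"] core(2) car t(2) by auto
  then have "(r \<otimes> t \<ominus> s \<otimes> w) \<oplus> s \<otimes> w \<in> M"
    using s t(2) by (intro M.a_closed M.I_r_closed)
  moreover have "(r \<otimes> t \<ominus> s \<otimes> w) \<oplus> s \<otimes> w = r \<otimes> t" using car t(2) by algebra
  ultimately show False using M.I_prime[of r t] r t(1) by auto
qed

end

section \<open>The implications\<close>

context affine_bidifferential_algebra
begin

lemma nat_units:
  assumes "characteristic_zero k" "n > 0"
  shows "add_pow R (n::nat) \<one> \<in> Units R"
proof -
  interpret h: ring_hom_ring k R \<phi>
    by (rule ring_hom_ringI2[OF base.ring_axioms ring_axioms structure_hom])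
  have hom: "\<phi> (add_pow k m \<one>\<^bsub>k\<^esub>) = add_pow R m \<one>" for m :: nat
    by (induction m) simp_all
  have "add_pow k n \<one>\<^bsub>k\<^esub> \<in> Units k"
    using assms base.field_Units by (simp add: characteristic_zero_def)
  then obtain c where "c \<in> carrier k" "add_pow k n \<one>\<^bsub>k\<^esub> \<otimes>\<^bsub>k\<^esub> c = \<one>\<^bsub>k\<^esub>"
    using base.Units_r_inv_ex by blast
  then have "\<phi> c \<in> carrier R" "add_pow R n \<one> \<otimes> \<phi> c = \<one>"
    using h.hom_mult[of "add_pow k n \<one>\<^bsub>k\<^esub>" c] hom[of n] by simp_all
  then show ?thesis
    unfolding Units_def using m_comm[of "\<phi> c" "add_pow R n \<one>"] by auto
qed

text \<open>Serves both implications: with an \<open>f\<close> outside \<open>P\<close> it makes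
  \<open>R Quot M\<close> a field, and with \<open>f = \<one>\<close> it makes the residue field of
  a maximal ideal algebraic over \<open>k\<close>.\<close>

lemma quotient_algebraic:
  assumes M: "ideal M R" and f: "f \<in> carrier R" "\<And>n::nat. f [^] n \<notin> M"
    and max: "\<forall>I. ideal I R \<longrightarrow> M \<subseteq> I \<longrightarrow> (\<forall>n::nat. f [^] n \<notin> I) \<longrightarrow> I = M"
  shows "subfield ((\<lambda>c. M +> \<phi> c) ` carrier k) (R Quot M)"
    and "x \<in> carrier (R Quot M) \<Longrightarrow>
      (ring.algebraic (R Quot M) over ((\<lambda>c. M +> \<phi> c) ` carrier k)) x"
proof -
  note prime = avoiding_powers_prime[OF M f max]
  have fM: "f \<in> carrier R - M" using f(1) f(2)[of 1] by simp
  obtain S where S: "finite S" "S \<subseteq> carrier R" "generate_ring R (\<phi> ` carrier k \<union> S) = carrier R"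
    using finitely_generated by blast
  note * = quotient_finitely_generated_algebraic[OF base.field_axioms structure_hom S prime fM
      divides_power_mod[OF M f max]]
  show "subfield ((\<lambda>c. M +> \<phi> c) ` carrier k) (R Quot M)" by (rule *(1))
  show "(ring.algebraic (R Quot M) over ((\<lambda>c. M +> \<phi> c) ` carrier k)) x"
    if "x \<in> carrier (R Quot M)" by (rule *(2)[OF _ that])
qed

lemma B_locally_closed_imp_B_primitive:
  assumes char: "characteristic_zero k" and P: "P \<in> Spec_B R bd" and lc: "B_locally_closed R bd P"
  shows "B_primitive R bd P"
proof -
  interpret P: primeideal P R using P by (simp add: Spec_B_def)
  have "P \<subseteq> carrier R \<inter> \<Inter> {Q \<in> Spec_B R bd. P \<subset> Q}" using P.a_subset by auto
  then obtain f where f: "f \<in> carrier R" "f \<notin> P"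
    and f_mem: "\<And>Q. Q \<in> Spec_B R bd \<Longrightarrow> P \<subset> Q \<Longrightarrow> f \<in> Q"
    using lc unfolding B_locally_closed_def by blast
  have "f [^] n \<notin> P" for n :: nat
    using P.pow_mem_imp_mem f by blast
  then obtain M where M: "ideal M R" "P \<subseteq> M" "\<And>n::nat. f [^] n \<notin> M"
    "\<forall>I. ideal I R \<longrightarrow> M \<subseteq> I \<longrightarrow> (\<forall>n::nat. f [^] n \<notin> I) \<longrightarrow> I = M"
    using exists_ideal_avoiding_powers[OF P.ideal_axioms] by metis
  have prime: "primeideal M R"
    by (rule avoiding_powers_prime[OF M(1) f(1) M(3,4)])
  have "field (R Quot M)"
    by (rule domain.algebraic_imp_field[OF primeideal.quotient_is_domain[OF prime]
          quotient_algebraic[OF M(1) f(1) M(3,4)]])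
  then have max: "maximalideal M R" by (rule maximalideal_of_quotient_field[OF M(1)])
  note core = bidifferential_core_greatest[OF M(1)]
  have "bidifferential_core R bd M \<in> Spec_B R bd"
    using bidifferential_core_prime[OF prime nat_units[OF char]] core(1) by (simp add: Spec_B_def)
  moreover have "P \<subseteq> bidifferential_core R bd M"
    using core(3) P M(2) by (simp add: Spec_B_def)
  moreover have "f \<notin> bidifferential_core R bd M"
    using core(2) M(3)[of 1] f(1) by auto
  \<comment> \<open>Were the core strictly above \<open>P\<close>, it would contain
    \<open>f\<close>.\<close>
  ultimately have "P = bidifferential_core R bd M" using f_mem by blast
  then show ?thesis unfolding B_primitive_def using max by blast
qed

lemma B_primitive_imp_B_rational:
  assumes const: "\<phi> ` carrier k \<subseteq> constants R bd" and P: "P \<in> Spec_B R bd"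
    and prim: "B_primitive R bd P"
  shows "B_rational k \<phi> R bd P"
proof -
  obtain M where M: "maximalideal M R" and P_eq: "P = bidifferential_core R bd M"
    using prim unfolding B_primitive_def by blast
  interpret M: maximalideal M R by (rule M)
  have M_prime: "primeideal M R" by (rule maximalideal_prime[OF M])
  interpret P: primeideal P R using P by (simp add: Spec_B_def)
  have P_bd: "bidifferential_ideal R bd P" using P by (simp add: Spec_B_def)
  define A where "A = R Quot P"
  define F where "F = Frac A"
  define D where "D = Frac_bd A (Quot_bd R bd P)"
  define \<psi> where "\<psi> = (\<lambda>r. to_Frac A (P +> r))"
  interpret A: domain A unfolding A_def by (rule P.quotient_is_domain)
  interpret F: bidifferential_field F D
    unfolding F_def D_def A_def using Frac_Quot_bidifferential_field[OF bidifferential_ring_axioms P] .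
  have ext: "extends_to_Frac A (Quot_bd R bd P) D"
    unfolding D_def
    using A.Frac_bd_extends bidifferential_ring.biderivation[OF Quot_bidifferential_ring[OF P_bd]]
    by (simp add: A_def)
  have cos: "(+>) P \<in> ring_hom R A" unfolding A_def by (rule P.rcos_ring_hom)
  have \<psi>_hom: "\<psi> \<in> ring_hom R F"
    using ring_hom_trans[OF cos A.to_Frac_hom] by (simp add: \<psi>_def F_def comp_def)
  have cos_closed: "P +> r \<in> carrier A" if "r \<in> carrier R" for r
    using ring_hom_closed[OF cos that] .
  have \<psi>_zero: "\<psi> r = \<zero>\<^bsub>F\<^esub> \<longleftrightarrow> r \<in> P" if r: "r \<in> carrier R" for r
  proof -
    have "\<zero>\<^bsub>F\<^esub> = to_Frac A \<zero>\<^bsub>A\<^esub>" by (simp add: F_def A.frac_zero to_Frac_def)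
    then have "\<psi> r = \<zero>\<^bsub>F\<^esub> \<longleftrightarrow> P +> r = \<zero>\<^bsub>A\<^esub>"
      unfolding \<psi>_def using A.to_Frac_inj cos_closed[OF r] A.zero_closed by (metis inj_onD)
    then show ?thesis using P.coset_eq_zero_iff[OF r] by (simp add: A_def)
  qed
  interpret bidifferential_fractions R bd F D \<psi>
  proof unfold_locales
    show "\<psi> \<in> ring_hom R F" by (rule \<psi>_hom)
    show "D (\<psi> r) (\<psi> s) = \<psi> (bd r s)" if "r \<in> carrier R" "s \<in> carrier R" for r s
      using ext cos_closed[OF that(1)] cos_closed[OF that(2)] Quot_bd_coset[OF P_bd that]
      by (simp add: extends_to_Frac_def \<psi>_def)
    fix x assume x: "x \<in> carrier F"
    obtain a b where ab: "a \<in> carrier A" "b \<in> carrier A - {\<zero>\<^bsub>A\<^esub>}"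
      "x \<otimes>\<^bsub>F\<^esub> to_Frac A b = to_Frac A a"
      using A.Frac_quotient x unfolding F_def by blast
    then obtain s r where sr: "s \<in> carrier R" "a = P +> s" "r \<in> carrier R" "b = P +> r"
      unfolding A_def carrier_FactRing by blast
    have "\<psi> r \<in> carrier F" using ring_hom_closed[OF \<psi>_hom sr(3)] .
    then have "\<psi> r \<otimes>\<^bsub>F\<^esub> x = \<psi> s"
      using ab(3) x sr F.m_comm[of x "\<psi> r"] by (simp add: \<psi>_def)
    moreover have "\<psi> r \<noteq> \<zero>\<^bsub>F\<^esub>"
      using ab(2) sr \<psi>_zero[of r] P.coset_eq_zero_iff[of r] by (simp add: A_def)
    ultimately show "\<exists>r \<in> carrier R. \<exists>s \<in> carrier R. \<psi> r \<noteq> \<zero>\<^bsub>F\<^esub> \<and> \<psi> r \<otimes>\<^bsub>F\<^esub> x = \<psi> s"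
      using sr by blast
  qed
  interpret h: ring_hom_ring R F \<psi> by (rule ring_hom_ring)
  have core: "bidifferential_core R bd M \<subseteq> M"
    by (rule bidifferential_core_greatest(2)[OF M.ideal_axioms])
  have ker: "\<psi> r = \<zero>\<^bsub>F\<^esub> \<longleftrightarrow> r \<in> bidifferential_core R bd M" if "r \<in> carrier R" for r
    using \<psi>_zero[OF that] P_eq by simp
  have ker': "\<psi> r = \<zero>\<^bsub>F\<^esub>" if "r \<in> bidifferential_core R bd M" for r
    using that ker[of r] core M.Icarr by blast
  \<comment> \<open>The bracket with an arbitrary \<open>x\<close> of \<open>F\<close> has to
    vanish, not only the bracket with images from \<open>R\<close>; a denominator \<open>t\<close>
    of \<open>x\<close> reduces this to the latter.\<close>
  have \<psi>_const: "\<psi> r \<in> constants F D" if r: "r \<in> constants R bd" for r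
  proof (rule F.constantsI)
    note Dr = constantsD[OF r]
    show r': "\<psi> r \<in> carrier F" using Dr(1) by simp
    fix x assume x: "x \<in> carrier F"
    obtain t s where ts: "t \<in> carrier R" "s \<in> carrier R" "\<psi> t \<noteq> \<zero>\<^bsub>F\<^esub>" "\<psi> t \<otimes>\<^bsub>F\<^esub> x = \<psi> s"
      using fraction[OF x] by blast
    have zero: "D (\<psi> r) (\<psi> u) = \<zero>\<^bsub>F\<^esub>" "D (\<psi> u) (\<psi> r) = \<zero>\<^bsub>F\<^esub>" if "u \<in> carrier R" for u
      using bd_hom[OF Dr(1) that] bd_hom[OF that Dr(1)] Dr that by simp_all
    have "\<psi> t \<otimes>\<^bsub>F\<^esub> D (\<psi> r) x = D (\<psi> r) (\<psi> t \<otimes>\<^bsub>F\<^esub> x)" "\<psi> t \<otimes>\<^bsub>F\<^esub> D x (\<psi> r) = D (\<psi> t \<otimes>\<^bsub>F\<^esub> x) (\<psi> r)"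
      using F.bd_mult_right[of "\<psi> r" "\<psi> t" x] F.bd_mult_left[of "\<psi> r" "\<psi> t" x] zero[OF ts(1)] r' ts(1) x
      by simp_all
    then have "\<psi> t \<otimes>\<^bsub>F\<^esub> D (\<psi> r) x = \<zero>\<^bsub>F\<^esub>" "\<psi> t \<otimes>\<^bsub>F\<^esub> D x (\<psi> r) = \<zero>\<^bsub>F\<^esub>"
      unfolding ts(4) using zero[OF ts(2)] by simp_all
    then show "D (\<psi> r) x = \<zero>\<^bsub>F\<^esub>" "D x (\<psi> r) = \<zero>\<^bsub>F\<^esub>"
      using ts(1,3) r' x F.integral[of "\<psi> t" "D (\<psi> r) x"] F.integral[of "\<psi> t" "D x (\<psi> r)"] by auto
  qed
  have "(F.algebraic over ((\<lambda>c. \<psi> (\<phi> c)) ` carrier k)) x" if x: "x \<in> constants F D" for x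
  proof -
    have xF: "x \<in> carrier F" using F.constantsD(1)[OF x] .
    obtain r s where rs: "r \<in> carrier R - M" "s \<in> carrier R" "\<psi> r \<otimes>\<^bsub>F\<^esub> x = \<psi> s"
      using constant_denominator[OF M.ideal_axioms ker' x] by blast
    interpret B: field "R Quot M" by (rule M.quotient_is_field[OF cring_axioms])
    interpret B: ring_hom_ring R "R Quot M" "(+>) M" by (rule M.rcos_ring_hom_ring)
    have one: "\<one> [^] (n::nat) \<notin> M" for n using M.I_notcarr M.one_imp_carrier by auto
    have "I = M" if I: "ideal I R" "M \<subseteq> I" and "\<forall>n::nat. \<one> [^] n \<notin> I" for I
      using M.I_maximal[OF I] spec[OF that(3), of 0] ideal.Icarr[OF I(1)] by auto
    then have max: "\<forall>I. ideal I R \<longrightarrow> M \<subseteq> I \<longrightarrow> (\<forall>n::nat. \<one> [^] n \<notin> I) \<longrightarrow> I = M" by blast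
    note alg = quotient_algebraic[OF M.ideal_axioms one_closed one max]
    let ?K = "(\<lambda>c. M +> \<phi> c) ` carrier k"
    have "M +> r \<in> Units (R Quot M)"
      using B.field_Units rs(1) M.coset_eq_zero_iff[of r] B.hom_closed[of r] by auto
    then obtain i where i: "i \<in> carrier (R Quot M)" "(M +> r) \<otimes>\<^bsub>R Quot M\<^esub> i = \<one>\<^bsub>R Quot M\<^esub>"
      using B.Units_r_inv_ex by blast
    \<comment> \<open>The value of \<open>x = s / r\<close> in the residue field.\<close>
    define y where "y = i \<otimes>\<^bsub>R Quot M\<^esub> (M +> s)"
    have y: "y \<in> carrier (R Quot M)" using i rs(2) by (simp add: y_def)
    have ry: "(M +> r) \<otimes>\<^bsub>R Quot M\<^esub> y = M +> s"
      using i rs B.m_assoc[of "M +> r" i "M +> s"] by (simp add: y_def)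
    obtain p' where p': "p' \<in> carrier (?K[X]\<^bsub>R Quot M\<^esub>)" "p' \<noteq> []" "B.eval p' y = \<zero>\<^bsub>R Quot M\<^esub>"
      using B.algebraicE[OF subfieldE(1)[OF alg(1)] y alg(2)[OF y]] by blast
    have "set p' \<subseteq> ?K" "hd p' \<noteq> \<zero>\<^bsub>R Quot M\<^esub>"
      using p'(1,2) by (auto simp: univ_poly_carrier[symmetric] polynomial_def)
    \<comment> \<open>The coefficients are lifted to \<open>k\<close>, since the same polynomial has
      to be read in both \<open>R Quot M\<close> and \<open>F\<close>.\<close>
    then have "p' \<in> lists ?K" by (simp add: in_lists_conv_set subset_iff)
    then obtain q where "q \<in> lists (carrier k)" and q_map: "p' = map (\<lambda>c. M +> \<phi> c) q"
      unfolding lists_image by (rule imageE)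
    with q_map have q: "set q \<subseteq> carrier k" "p' = map (\<lambda>c. M +> \<phi> c) q"
      by (auto simp: in_lists_conv_set)
    define p where "p = map \<phi> q"
    have p: "set p \<subseteq> carrier R"
      using q(1) ring_hom_closed[OF structure_hom] by (auto simp: p_def)
    \<comment> \<open>A single element of \<open>R\<close> that links the two evaluations: up to a
      power of \<open>r\<close> it becomes \<open>q(y) = 0\<close> in \<open>R Quot M\<close> and
      \<open>q(x)\<close> in \<open>F\<close>.\<close>
    define H where "H = homogenize p s r"
    have H: "H \<in> carrier R" using p rs by (simp add: H_def)
    have "M +> H = \<zero>\<^bsub>R Quot M\<^esub>"
      using hom_homogenize[OF B.homh B.cring_axioms p _ rs(2) y ry] rs(1) p'(3) q(2)
      by (simp add: H_def p_def comp_def)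
    then have HM: "H \<in> M" using M.coset_eq_zero_iff[OF H] by simp
    define e where "e = F.eval (map \<psi> p) x"
    have "\<psi> H = \<psi> r [^]\<^bsub>F\<^esub> length p \<otimes>\<^bsub>F\<^esub> e"
      using hom_homogenize[OF h.homh F.cring_axioms p _ rs(2) xF rs(3)] rs(1) by (simp add: H_def e_def)
    then have H_eq: "\<psi> (r [^] length p) \<otimes>\<^bsub>F\<^esub> e = \<psi> H"
      using rs(1) by (simp add: h.hom_nat_pow)
    have "set (map \<psi> p) \<subseteq> constants F D"
      using q(1) const \<psi>_const by (auto simp: p_def)
    then have e: "e \<in> constants F D" unfolding e_def using x by (rule F.eval_constants)
    have "r [^] n \<notin> M" for n :: nat
      using primeideal.pow_mem_imp_mem[OF M_prime] rs(1) by blast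
    then have "e = \<zero>\<^bsub>F\<^esub>"
      using rs(1) by (intro constant_zero[OF M_prime ker e _ HM H_eq]) simp_all
    show ?thesis
    proof (rule F.algebraicI)
      show "map \<psi> p \<noteq> []" using p'(2) q(2) by (simp add: p_def)
      show "F.eval (map \<psi> p) x = \<zero>\<^bsub>F\<^esub>" using \<open>e = \<zero>\<^bsub>F\<^esub>\<close> by (simp add: e_def)
      have "q \<noteq> []" using p'(2) q(2) by simp
      then have hd_q: "hd q \<in> carrier k"
        using q(1) hd_in_set by blast
      \<comment> \<open>Polynomials are lists with nonzero head. The head survives modulo
        \<open>M\<close>, hence lies outside \<open>P \<subseteq> M\<close> and survives in
        \<open>F\<close>.\<close>
      have "M +> \<phi> (hd q) \<noteq> \<zero>\<^bsub>R Quot M\<^esub>"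
        using q(2) \<open>q \<noteq> []\<close> \<open>hd p' \<noteq> \<zero>\<^bsub>R Quot M\<^esub>\<close> by (simp add: hd_map)
      then have "\<phi> (hd q) \<notin> P"
        using M.coset_eq_zero_iff[of "\<phi> (hd q)"] core P_eq ring_hom_closed[OF structure_hom hd_q] by blast
      then have "\<psi> (\<phi> (hd q)) \<noteq> \<zero>\<^bsub>F\<^esub>"
        using \<psi>_zero ring_hom_closed[OF structure_hom hd_q] by simp
      then show "map \<psi> p \<in> carrier (((\<lambda>c. \<psi> (\<phi> c)) ` carrier k)[X]\<^bsub>F\<^esub>)"
        using q(1) \<open>q \<noteq> []\<close> by (auto simp: univ_poly_carrier[symmetric] polynomial_def p_def hd_map)
    qed
  qed
  then show ?thesis
    unfolding B_rational_def Let_def A_def[symmetric] F_def[symmetric] D_def[symmetric]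
    by (simp add: \<psi>_def)
qed

end

theorem proposition4p3:
  fixes k :: "('k, 'm) ring_scheme" and R :: "('a, 'n) ring_scheme"
    and bdk :: "'k \<Rightarrow> 'k \<Rightarrow> 'k" and bd :: "'a \<Rightarrow> 'a \<Rightarrow> 'a" and \<phi> :: "'k \<Rightarrow> 'a"
  assumes "bidifferential_field k bdk"
    and "characteristic_zero k"
    and "affine_bidifferential_algebra k bdk R bd \<phi>"
    and "P \<in> Spec_B R bd"
  shows "(B_locally_closed R bd P \<longrightarrow> B_primitive R bd P) \<and>
         (\<phi> ` carrier k \<subseteq> constants R bd \<longrightarrow> B_primitive R bd P \<longrightarrow> B_rational k \<phi> R bd P)"
  using affine_bidifferential_algebra.B_locally_closed_imp_B_primitive[OF assms(3,2,4)]
    affine_bidifferential_algebra.B_primitive_imp_B_rational[OF assms(3) _ assms(4)]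
  by blast

end
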